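(* Let $G$ be a finite group. Then $\mathscr{I}_c(G)$ is complete if and only if $G$ is isomorphic to either $\mathbb{Z}_{p^\alpha}$ for some prime $p$ and some integer $\alpha\geq 1$, or $Q_{2^\alpha}$ for some integer $\alpha\geq 3$. In this case, $\mathscr{I}_c(\mathbb{Z}_{p^\alpha})\cong K_{\alpha-1}$ and $\mathscr{I}_c(Q_{2^\alpha})\cong K_{2^{\alpha-2}+\alpha-1}$.
   Context: For a group $G$, the intersection graph of cyclic subgroups of $G$, denoted $\mathscr{I}_c(G)$, is the simple graph whose vertices are all the proper cyclic subgroups of $G$ (cyclic subgroups different from $G$ and from the trivial subgroup), two distinct vertices being adjacent if and only if their intersection is a non-trivial subgroup. $K_n$ denotes the complete graph on $n$ vertices ($K_0$ being the graph with no vertices), and a graph is complete if any two distinct vertices are adjacent. $\mathbb{Z}_m$ is the cyclic group of order $m$. For $\alpha\geq 3$, $Q_{2^\alpha}=\langle a,b \mid a^{2^{\alpha-1}}=1,\ b^2=a^{2^{\alpha-2}},\ bab^{-1}=a^{-1}\rangle$ is the generalized quaternion group of order $2^\alpha$.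
   Formalization: The group G is additionally assumed to be nontrivial: for the trivial group the graph has no vertices and so is complete, yet the group is neither Z_{p^α} with α ≥ 1 nor Q_{2^α}. *)

theory Defs
  imports "HOL-Algebra.Elementary_Groups" "HOL-Computational_Algebra.Primes"
    "Graph_Theory.Kuratowski"
begin

section \<open>The intersection graph of cyclic subgroups\<close>

definition proper_cyclic_subgroups :: "('a, 'b) monoid_scheme \<Rightarrow> 'a set set" where
  "proper_cyclic_subgroups G =
     {H. subgroup H G \<and> cyclic_group (G\<lparr>carrier := H\<rparr>) \<and> H \<noteq> carrier G \<and> H \<noteq> {\<one>\<^bsub>G\<^esub>}}"

text \<open>Following \<^theory>\<open>Graph_Theory.Digraph\<close>, an undirected edge is represented by
  the two arcs between its ends; see \<open>graph_cyclic_intersection_graph\<close> below.\<close>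

definition cyclic_intersection_graph ::
    "('a, 'b) monoid_scheme \<Rightarrow> ('a set, 'a set \<times> 'a set) pre_digraph" where
  "cyclic_intersection_graph G = with_proj
     \<lparr> pverts = proper_cyclic_subgroups G,
       parcs = {(H, K). H \<in> proper_cyclic_subgroups G \<and> K \<in> proper_cyclic_subgroups G
                  \<and> H \<noteq> K \<and> H \<inter> K \<noteq> {\<one>\<^bsub>G\<^esub>}} \<rparr>"

definition is_complete_graph :: "('v, 'e) pre_digraph \<Rightarrow> bool" where
  "is_complete_graph \<Gamma> \<longleftrightarrow> (\<forall>u \<in> verts \<Gamma>. \<forall>v \<in> verts \<Gamma>. u \<noteq> v \<longrightarrow> u \<rightarrow>\<^bsub>\<Gamma>\<^esub> v)"

lemma graph_cyclic_intersection_graph: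
  assumes "finite (carrier G)"
  shows "graph (cyclic_intersection_graph G)"
proof -
  let ?V = "proper_cyclic_subgroups G"
  let ?P = "\<lparr> pverts = ?V, parcs = {(H, K). H \<in> ?V \<and> K \<in> ?V \<and> H \<noteq> K \<and> H \<inter> K \<noteq> {\<one>\<^bsub>G\<^esub>}} \<rparr>"
  have "?V \<subseteq> Pow (carrier G)"
    by (auto simp: proper_cyclic_subgroups_def dest: subgroup.subset)
  then have fin: "finite ?V"
    using assms by (meson finite_Pow_iff finite_subset)
  have "finite (parcs ?P)"
    by (rule finite_subset[of _ "?V \<times> ?V"]) (use fin in auto)
  then interpret pair_graph ?P
    using fin by unfold_locales (auto simp: symmetric_def intro!: symI)
  show ?thesis
    unfolding cyclic_intersection_graph_def by unfold_locales
qed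


section \<open>Groups given by generators and relations\<close>

text \<open>The letter \<open>(False, x)\<close> stands for the generator \<open>x\<close> and \<open>(True, x)\<close> for its formal
  inverse. Relations are pairs \<open>(u, v)\<close> of words, read as \<open>u = v\<close>.\<close>

type_synonym 'g word = "(bool \<times> 'g) list"

inductive word_eq :: "('g word \<times> 'g word) set \<Rightarrow> 'g word \<Rightarrow> 'g word \<Rightarrow> bool" for R where
  refl: "word_eq R u u"
| sym: "word_eq R u v \<Longrightarrow> word_eq R v u"
| trans: "word_eq R u v \<Longrightarrow> word_eq R v w \<Longrightarrow> word_eq R u w"
| append: "word_eq R u u' \<Longrightarrow> word_eq R v v' \<Longrightarrow> word_eq R (u @ v) (u' @ v')"
| cancel: "word_eq R [(i, x), (\<not> i, x)] []"
| rel: "(u, v) \<in> R \<Longrightarrow> word_eq R u v"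

definition presented_group :: "('g word \<times> 'g word) set \<Rightarrow> 'g word set monoid" where
  "presented_group R =
     \<lparr> carrier = UNIV // {(u, v). word_eq R u v},
       monoid.mult = (\<lambda>X Y. {w. \<exists>u\<in>X. \<exists>v\<in>Y. word_eq R (u @ v) w}),
       one = {w. word_eq R [] w} \<rparr>"

lemma presented_group_carrier:
  "carrier (presented_group R) = range (\<lambda>u. {w. word_eq R u w})"
  by (auto simp: presented_group_def quotient_def)

lemma presented_group_mult:
  "{w. word_eq R u w} \<otimes>\<^bsub>presented_group R\<^esub> {w. word_eq R v w} = {w. word_eq R (u @ v) w}"
  by (auto simp: presented_group_def intro: word_eq.intros)

lemma word_eq_inverse: "word_eq R (rev (map (map_prod Not id) u) @ u) []"
proof (induction u)
  case Nil
  show ?case by (simp add: word_eq.refl)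
next
  case (Cons l u)
  obtain i x where l: "l = (i, x)" by (cases l)
  let ?u' = "rev (map (map_prod Not id) u)"
  have "word_eq R ([(\<not> i, x), (i, x)] @ u) ([] @ u)"
    using word_eq.cancel[of R "\<not> i" x] by (intro word_eq.append word_eq.refl) simp
  then have "word_eq R (?u' @ [(\<not> i, x), (i, x)] @ u) (?u' @ u)"
    by (intro word_eq.append[of R ?u' ?u'] word_eq.refl) simp
  then have "word_eq R (?u' @ [(\<not> i, x), (i, x)] @ u) []"
    using Cons.IH by (rule word_eq.trans)
  then show ?case
    by (simp add: l id_def)
qed

lemma group_presented_group: "group (presented_group R)"
proof (rule groupI)
  let ?G = "presented_group R"
  have one: "\<one>\<^bsub>?G\<^esub> = {w. word_eq R [] w}"
    by (simp add: presented_group_def)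
  show "\<one>\<^bsub>?G\<^esub> \<in> carrier ?G"
    by (auto simp: one presented_group_carrier)
  fix X assume X: "X \<in> carrier ?G"
  then obtain u where u: "X = {w. word_eq R u w}"
    by (auto simp: presented_group_carrier)
  show "\<one>\<^bsub>?G\<^esub> \<otimes>\<^bsub>?G\<^esub> X = X"
    by (simp add: one u presented_group_mult)
  have "{w. word_eq R (rev (map (map_prod Not id) u) @ u) w} = {w. word_eq R [] w}"
    using word_eq_inverse[of R u] by (auto intro: word_eq.sym word_eq.trans)
  then show "\<exists>Y\<in>carrier ?G. Y \<otimes>\<^bsub>?G\<^esub> X = \<one>\<^bsub>?G\<^esub>"
    by (auto simp: one u presented_group_carrier presented_group_mult)
  fix Y assume "Y \<in> carrier ?G"
  then show "X \<otimes>\<^bsub>?G\<^esub> Y \<in> carrier ?G"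
    using X by (auto simp: presented_group_carrier presented_group_mult)
  fix Z assume "Z \<in> carrier ?G"
  then show "X \<otimes>\<^bsub>?G\<^esub> Y \<otimes>\<^bsub>?G\<^esub> Z = X \<otimes>\<^bsub>?G\<^esub> (Y \<otimes>\<^bsub>?G\<^esub> Z)"
    using X \<open>Y \<in> carrier ?G\<close> by (auto simp: presented_group_carrier presented_group_mult)
qed


section \<open>Generalized quaternion groups\<close>

datatype quaternion_gen = gen_a | gen_b

text \<open>The group of order \<open>2 ^ \<alpha>\<close>; meaningful only for \<open>\<alpha> \<ge> 3\<close>.\<close>

definition generalized_quaternion_group :: "nat \<Rightarrow> quaternion_gen word set monoid" where
  "generalized_quaternion_group \<alpha> =
     (let a = (False, gen_a); a' = (True, gen_a); b = (False, gen_b); b' = (True, gen_b)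
      in presented_group
        {(replicate (2 ^ (\<alpha> - 1)) a, []),
         ([b, b], replicate (2 ^ (\<alpha> - 2)) a),
         ([b, a, b'], [a'])})"

end

theory Submission
  imports Defs Complex_Main "HOL-Algebra.Group_Action" "HOL-Algebra.Sylow"
    "HOL-Number_Theory.Residues"
begin

text \<open>Write \<open>\<langle>x\<rangle>\<close> for the cyclic subgroup generated by \<open>x\<close>.

  For a nontrivial finite group, completeness of the graph is the same as the existence of an
  element \<open>z \<noteq> \<one>\<close> that is a power of every element \<open>x \<noteq> \<one>\<close>, in other words of a smallest nontrivial subgroup. If \<open>z\<close> exists, it lies in every
  vertex. Conversely, if the graph is complete, any two elements of prime order generate the same
  subgroup, since subgroups of prime order can only meet nontrivially by being equal
  (\<open>common_element_if_complete\<close>); by Sylow's theorem \<open>G\<close> is then a \<open>p\<close>-group.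

  The core of the proof is therefore the classical fact that a finite \<open>p\<close>-group with only one
  subgroup of order \<open>p\<close> is cyclic or generalized quaternion (\<open>cyclic_or_quaternion\<close>). Choose
  \<open>C = \<langle>c\<rangle>\<close> normal and of maximal order. A fixed point argument for the action of \<open>G\<close> on cosets of \<open>C\<close>
  shows that \<open>C\<close> is its own centralizer. An element \<open>y\<close> outside \<open>C\<close> with \<open>y ^ p \<in> C\<close> acts on \<open>C\<close> as
  some power map \<open>c \<mapsto> c ^ k\<close>, and \<open>(c ^ j y) ^ p = c ^ (j (1 + k + \<dots> + k ^ (p - 1))) y ^ p\<close>. If the
  exponent of \<open>p\<close> in the sum of the powers of \<open>k\<close> is one, then either \<open>y ^ p\<close> generates \<open>C\<close>, so that \<open>y\<close>
  centralizes \<open>C\<close>, or \<open>j\<close> can be chosen so that \<open>c ^ j y\<close>, which lies outside \<open>C\<close>, has order \<open>p\<close>.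
  Both are impossible. The only escape is \<open>p = 2\<close> with \<open>k \<equiv> 3\<close> modulo \<open>4\<close>; then \<open>y\<close> inverts \<open>c\<close> and
  \<open>y\<^sup>2\<close> is the involution of \<open>C\<close> (\<open>noncommuting_extension\<close>). As \<open>- 1\<close> is not a square modulo \<open>4\<close>,
  nothing more can lie between \<open>C\<close> and \<open>G\<close>.

  By its relations, every element of the presented quaternion group can be written as \<open>a ^ i b ^ j\<close> with
  \<open>j \<le> 1\<close>, and a homomorphism to the unit quaternions shows that there are no further coincidences
  (\<open>quaternion_generators_presented_group\<close>). This identifies it with the group found above.
  The vertices are then counted in both cases: the nontrivial subgroups of a cyclic group of order
  \<open>p ^ n\<close> are the \<open>\<langle>c ^ (p ^ i)\<rangle>\<close> for \<open>i < n\<close>, and in the quaternion group the \<open>2 ^ n\<close> elements outside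
  \<open>\<langle>c\<rangle>\<close> contribute one cyclic subgroup of order \<open>4\<close> for each two elements.\<close>

section \<open>Powers of an element\<close>

context group
begin

lemma mem_generate_singleton_iff:
  "a \<in> carrier G \<Longrightarrow> x \<in> generate G {a} \<longleftrightarrow> (\<exists>k::int. x = a [^] k)"
  by (auto simp: generate_pow)

lemma mem_generate_singleton_nat:
  assumes "finite (carrier G)" "a \<in> carrier G" "x \<in> generate G {a}"
  obtains k :: nat where "x = a [^] k"
  using assms(3) generate_pow_on_finite_carrier[OF assms(1,2)] by auto

lemma int_pow_mem_generate: "a \<in> carrier G \<Longrightarrow> a [^] (k::int) \<in> generate G {a}"
  by (auto simp: mem_generate_singleton_iff)

lemma nat_pow_mem_generate: "a \<in> carrier G \<Longrightarrow> a [^] (k::nat) \<in> generate G {a}"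
  using int_pow_mem_generate[of a "int k"] by (simp add: int_pow_int)

lemma subgroup_generate_singleton: "a \<in> carrier G \<Longrightarrow> subgroup (generate G {a}) G"
  by (simp add: generate_is_subgroup)

lemma generate_singleton_subset:
  assumes "a \<in> carrier G" "x \<in> generate G {a}"
  shows "generate G {x} \<subseteq> generate G {a}"
  using assms by (simp add: generate_subgroup_incl subgroup_generate_singleton)

lemma generate_singleton_trans:
  assumes "a \<in> carrier G" "x \<in> generate G {a}" "y \<in> generate G {x}"
  shows "y \<in> generate G {a}"
  using generate_singleton_subset[OF assms(1,2)] assms(3) by blast

lemma int_pow_eq_iff_cong:
  "x \<in> carrier G \<Longrightarrow> x [^] (i::int) = x [^] j \<longleftrightarrow> [i = j] (mod int (ord x))"
  using int_pow_eq[of x i j] by (metis cong_iff_dvd_diff cong_sym)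

lemma generate_int_pow_coprime:
  assumes x: "x \<in> carrier G" and "coprime k (int (ord x))"
  shows "generate G {x [^] k} = generate G {x}"
proof
  show "generate G {x [^] k} \<subseteq> generate G {x}"
    by (simp add: x generate_singleton_subset int_pow_mem_generate)
  obtain v where "[k * v = 1] (mod int (ord x))"
    using assms(2) coprime_iff_invertible_int by auto
  then have "x [^] (k * v) = x [^] (1::int)"
    unfolding int_pow_eq_iff_cong[OF x] .
  then have "x = (x [^] k) [^] v"
    by (simp add: x int_pow_pow)
  then have "x \<in> generate G {x [^] k}"
    using x mem_generate_singleton_iff by blast
  then show "generate G {x} \<subseteq> generate G {x [^] k}"
    by (simp add: x generate_singleton_subset)
qed

lemma generator_of_prime_order:
  assumes x: "x \<in> carrier G" and "prime (ord x)" and y: "y \<in> generate G {x}" "y \<noteq> \<one>"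
  shows "x \<in> generate G {y}"
proof -
  obtain k :: int where k: "y = x [^] k"
    using x y mem_generate_singleton_iff by blast
  have "\<not> int (ord x) dvd k"
    using k y(2) x int_pow_eq_id by blast
  then have "coprime k (int (ord x))"
    using \<open>prime (ord x)\<close> by (metis coprime_commute prime_imp_coprime prime_nat_int_transfer)
  then show ?thesis
    using generate_int_pow_coprime[OF x] k x by (simp add: generate.incl)
qed

lemma exists_power_of_prime_order:
  assumes "finite (carrier G)" and x: "x \<in> carrier G" "x \<noteq> \<one>"
  obtains k :: nat where "prime (ord (x [^] k))"
proof -
  have "ord x \<noteq> 1"
    using x ord_eq_1 by blast
  then obtain p where p: "prime p" "p dvd ord x"
    using prime_factor_nat by blast
  have "0 < ord x"
    using ord_ge_1[OF assms(1) x(1)] by simp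
  then have "ord (x [^] (ord x div p)) = p"
    using p x(1) by (auto simp: ord_pow dvd_div_eq_0_iff elim!: dvdE)
  then show ?thesis
    using that[of "ord x div p"] p(1) by simp
qed

end


section \<open>Fixed points of groups of prime power order\<close>

text \<open>Every orbit that is not a single point has a size divisible by \<open>p\<close>, so the number of fixed
  points in \<open>A\<close> is divisible by \<open>p\<close>; hence \<open>x\<close> is not the only one.\<close>

lemma (in group_action) fixed_point_of_prime_power_order:
  assumes "prime p" "order G = p ^ n" "A \<subseteq> E" "finite A" "p dvd card A"
    and inv: "\<And>g x. g \<in> carrier G \<Longrightarrow> x \<in> A \<Longrightarrow> \<phi> g x \<in> A"
    and x: "x \<in> A" "\<And>g. g \<in> carrier G \<Longrightarrow> \<phi> g x = x"
  shows "\<exists>y\<in>A - {x}. \<forall>g\<in>carrier G. \<phi> g y = y"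
proof (rule ccontr)
  assume no: "\<not> ?thesis"
  let ?O = "orbit G \<phi> ` (A - {x})"
  have sub: "orbit G \<phi> y \<subseteq> A" if "y \<in> A" for y
    using that inv by (auto simp: orbit_def)
  have notx: "x \<notin> orbit G \<phi> y" if "y \<in> A - {x}" for y
  proof
    assume "x \<in> orbit G \<phi> y"
    then have "y \<in> orbit G \<phi> x"
      using orbit_sym[of y x] that x(1) \<open>A \<subseteq> E\<close> by blast
    then show False
      using that x(2) by (auto simp: orbit_def)
  qed
  have part: "A - {x} = \<Union>?O"
  proof
    show "A - {x} \<subseteq> \<Union>?O"
      using orbit_refl \<open>A \<subseteq> E\<close> by blast
    show "\<Union>?O \<subseteq> A - {x}"
      using sub notx by blast
  qed
  have "p dvd card Y" if Y: "Y \<in> ?O" for Y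
  proof -
    obtain y where y: "y \<in> A - {x}" "Y = orbit G \<phi> y"
      using Y by blast
    then obtain g where g: "g \<in> carrier G" "\<phi> g y \<noteq> y"
      using no by blast
    have "{y, \<phi> g y} \<subseteq> Y"
      using y g orbit_refl \<open>A \<subseteq> E\<close> by (auto simp: orbit_def)
    moreover have "finite Y"
      using y sub \<open>finite A\<close> finite_subset by blast
    ultimately have "card Y \<noteq> 1"
      using g(2) by (metis card_1_singletonE insert_subset singletonD)
    moreover have "card Y dvd p ^ n"
      using orbit_stabilizer_theorem[of y] y \<open>A \<subseteq> E\<close> \<open>order G = p ^ n\<close>
      by (metis DiffD1 dvd_triv_left subsetD)
    ultimately show ?thesis
      using \<open>prime p\<close> by (metis divides_primepow_nat dvd_power gr0I power_0)
  qed
  then have "p dvd sum card ?O"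
    by (simp add: dvd_sum)
  moreover have "card (\<Union>?O) = sum card ?O"
  proof (rule card_Union_disjoint)
    show "pairwise disjnt ?O"
      using disjoint_union \<open>A \<subseteq> E\<close>
      unfolding pairwise_def disjnt_def orbits_def by blast
    show "finite Y" if "Y \<in> ?O" for Y
      using that sub \<open>finite A\<close> finite_subset by blast
  qed
  ultimately have "p dvd card A - 1"
    using part x(1) \<open>finite A\<close> by (metis card_Diff_singleton)
  moreover have "card A > 0"
    using x(1) \<open>finite A\<close> card_gt_0_iff by blast
  ultimately have "p dvd 1"
    using \<open>p dvd card A\<close> dvd_diffD1[of p "card A" 1] by simp
  then show False
    using \<open>prime p\<close> by simp
qed


section \<open>Adjoining an element to a cyclic normal subgroup\<close>

text \<open>Write \<open>k = 1 + p t\<close>. Modulo \<open>p\<^sup>2\<close> the sum is \<open>p + p t (0 + 1 + \<dots> + (p - 1))\<close>, and the triangular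
  number is divisible by \<open>p\<close> because \<open>p\<close> is odd. So \<open>p\<close> divides the sum exactly once; for
  \<open>p = 2\<close> the sum is \<open>1 + k\<close>, which can be divisible by \<open>4\<close>, and this is where the quaternion groups
  come from.\<close>

lemma geometric_sum_cong_prime_square:
  fixes k :: int
  assumes "odd p" "[k = 1] (mod int p)"
  shows "[(\<Sum>i<p. k ^ i) = int p] (mod (int p)\<^sup>2)"
proof -
  let ?p = "int p"
  obtain t where k: "k = 1 + ?p * t"
    using assms(2) by (metis cong_iff_lin cong_sym)
  have pow: "[k ^ i = 1 + int i * (?p * t)] (mod ?p\<^sup>2)" for i
  proof (induction i)
    case (Suc i)
    have "[k ^ i * k = (1 + int i * (?p * t)) * k] (mod ?p\<^sup>2)"
      using Suc by (rule cong_scalar_right)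
    also have "(1 + int i * (?p * t)) * k = 1 + int (Suc i) * (?p * t) + ?p\<^sup>2 * (int i * t\<^sup>2)"
      by (simp add: k algebra_simps power2_eq_square)
    also have "[\<dots> = 1 + int (Suc i) * (?p * t)] (mod ?p\<^sup>2)"
      by (simp add: cong_def)
    finally show ?case
      by (simp add: mult.commute)
  qed simp
  have gauss: "2 * (\<Sum>i<n. int i) = int n * (int n - 1)" for n
    by (induction n) (auto simp: algebra_simps)
  obtain h where h: "?p - 1 = 2 * h"
    using \<open>odd p\<close> by (metis even_of_nat odd_two_times_div_two_succ add_diff_cancel_right')
  have "[(\<Sum>i<p. k ^ i) = (\<Sum>i<p. 1 + int i * (?p * t))] (mod ?p\<^sup>2)"
    by (rule cong_sum) (rule pow)
  also have "(\<Sum>i<p. 1 + int i * (?p * t)) = ?p + (\<Sum>i<p. int i) * (?p * t)"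
    by (simp add: sum.distrib sum_distrib_right)
  also have "(\<Sum>i<p. int i) = ?p * h"
    using gauss[of p] h by (simp add: algebra_simps)
  also have "?p + ?p * h * (?p * t) = ?p + ?p\<^sup>2 * (h * t)"
    by (simp add: power2_eq_square algebra_simps)
  also have "[\<dots> = ?p] (mod ?p\<^sup>2)"
    by (simp add: cong_def)
  finally show ?thesis .
qed

context group
begin

lemma conj_int_pow:
  assumes cy: "c \<in> carrier G" "y \<in> carrier G" and conj: "y \<otimes> c = c [^] (k::int) \<otimes> y"
  shows "y \<otimes> c [^] (j::int) = c [^] (j * k) \<otimes> y"
proof -
  have "c [^] k = y \<otimes> c \<otimes> inv y"
    using conj cy by (simp add: m_assoc)
  moreover have "(y \<otimes> c \<otimes> inv y) [^] j = y \<otimes> c [^] j \<otimes> inv y"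
  proof -
    interpret group_hom G G "\<lambda>x. y \<otimes> x \<otimes> inv y"
      by unfold_locales (use cy in \<open>auto simp: hom_def m_assoc inv_solve_left\<close>)
    show ?thesis
      using hom_int_pow[OF cy(1)] by simp
  qed
  ultimately have "c [^] (k * j) = y \<otimes> c [^] j \<otimes> inv y"
    using cy by (simp flip: int_pow_pow)
  then show ?thesis
    using cy by (simp add: m_assoc mult.commute)
qed

lemma nat_pow_conj_int_pow:
  assumes cy: "c \<in> carrier G" "y \<in> carrier G" and conj: "y \<otimes> c = c [^] (k::int) \<otimes> y"
  shows "y [^] (m::nat) \<otimes> c [^] (j::int) = c [^] (j * k ^ m) \<otimes> y [^] m"
proof (induction m arbitrary: j)
  case (Suc m)
  have "y [^] Suc m \<otimes> c [^] j = y [^] m \<otimes> (y \<otimes> c [^] j)"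
    using cy by (simp add: m_assoc)
  also have "\<dots> = y [^] m \<otimes> c [^] (j * k) \<otimes> y"
    using cy conj_int_pow[OF cy conj] by (simp add: m_assoc)
  finally show ?case
    using cy Suc.IH[of "j * k"] by (simp add: m_assoc mult_ac)
qed (use cy in simp)

lemma nat_pow_mult_conj:
  assumes cy: "c \<in> carrier G" "y \<in> carrier G" and conj: "y \<otimes> c = c [^] (k::int) \<otimes> y"
  shows "(c [^] (j::int) \<otimes> y) [^] (m::nat) = c [^] (j * (\<Sum>i<m. k ^ i)) \<otimes> y [^] m"
proof (induction m)
  case (Suc m)
  have "(c [^] j \<otimes> y) [^] Suc m = c [^] (j * (\<Sum>i<m. k ^ i)) \<otimes> (y [^] m \<otimes> c [^] j) \<otimes> y"
    using cy Suc.IH by (simp add: m_assoc)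
  also have "\<dots> = (c [^] (j * (\<Sum>i<m. k ^ i)) \<otimes> c [^] (j * k ^ m)) \<otimes> (y [^] m \<otimes> y)"
    using cy nat_pow_conj_int_pow[OF cy conj] by (simp add: m_assoc)
  finally show ?case
    using cy by (simp add: int_pow_mult distrib_left)
qed (use cy in simp)

end

text \<open>The last assumption says that all elements of order \<open>p\<close> already lie in the cyclic subgroup
  generated by \<open>c\<close>, as they do when the whole group has only one subgroup of order \<open>p\<close>. The lemmas
  below study an element \<open>y\<close> outside \<open>\<langle>c\<rangle>\<close> that normalizes \<open>\<langle>c\<rangle>\<close> and whose \<open>p\<close>-th power lies in it.\<close>

locale cyclic_extension = group G for G (structure) +
  fixes p n :: nat and c
  assumes p: "prime p" and c: "c \<in> carrier G" and ord_c: "ord c = p ^ n"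
    and pow_p_ne_one: "\<And>x. x \<in> carrier G \<Longrightarrow> x \<notin> generate G {c} \<Longrightarrow> x [^] p \<noteq> \<one>"
begin

lemma c_pow_eq_iff: "c [^] (i::int) = c [^] j \<longleftrightarrow> [i = j] (mod (int p ^ n))"
  using int_pow_eq_iff_cong[OF c] ord_c by simp

lemma mult_notin:
  assumes "y \<in> carrier G" "y \<notin> generate G {c}" "x \<in> generate G {c}"
  shows "x \<otimes> y \<notin> generate G {c}"
proof
  assume "x \<otimes> y \<in> generate G {c}"
  then have "inv x \<otimes> (x \<otimes> y) \<in> generate G {c}"
    using subgroup_generate_singleton[OF c] assms(3) by (simp add: subgroup.m_closed subgroup.m_inv_closed)
  moreover have "x \<in> carrier G"
    using assms(3) subgroup.mem_carrier[OF subgroup_generate_singleton[OF c]] by blast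
  ultimately show False
    using assms by (simp flip: m_assoc)
qed

lemma generator_mem_if_coprime:
  assumes y: "y \<in> carrier G" "y [^] p = c [^] (m::int)" and "\<not> int p dvd m"
  shows "c \<in> generate G {y}"
proof -
  have "coprime (int p) m"
    using p \<open>\<not> int p dvd m\<close> by (simp add: prime_imp_coprime)
  then have "coprime m (int (ord c))"
    by (simp add: ord_c coprime_commute)
  then have "c \<in> generate G {c [^] m}"
    using generate_int_pow_coprime[OF c] c by (simp add: generate.incl)
  moreover have "c [^] m \<in> generate G {y}"
    using y nat_pow_mem_generate by metis
  ultimately show ?thesis
    using generate_singleton_trans y(1) by blast
qed

text \<open>If \<open>u\<close> were prime to \<open>p\<close>, then \<open>j u \<equiv> - m\<close> modulo \<open>p ^ n\<close> would have a solution \<open>j\<close>, and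
  \<open>(c ^ j y) ^ p = c ^ (j p u) y ^ p\<close> would be trivial although \<open>c ^ j y\<close> lies outside \<open>\<langle>c\<rangle>\<close>.\<close>

lemma no_complement:
  assumes y: "y \<in> carrier G" "y \<notin> generate G {c}" and m: "y [^] p = c [^] (int p * m)"
    and conj: "y \<otimes> c = c [^] (k::int) \<otimes> y" and u: "(\<Sum>i<p. k ^ i) = int p * u"
  shows "int p dvd u"
proof (rule ccontr)
  assume "\<not> int p dvd u"
  then have "coprime u (int p ^ n)"
    using prime_imp_coprime[of "int p" u] p by (simp add: coprime_commute)
  then obtain v where v: "[u * v = 1] (mod (int p ^ n))"
    using coprime_iff_invertible_int by auto
  \<comment> \<open>The exponent \<open>- m v\<close> is the solution \<open>j\<close> of \<open>j u \<equiv> - m\<close>.\<close>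
  have "(c [^] (- m * v) \<otimes> y) [^] p = c [^] (- m * v * (int p * u) + int p * m)"
    unfolding int_pow_mult[OF c] using nat_pow_mult_conj[OF c y(1) conj, of "- m * v" p]
    by (simp only: m u)
  also have "\<dots> = c [^] (0::int)"
  proof -
    have "[- m * v * (int p * u) + int p * m = (u * v) * (- m * int p) + int p * m] (mod (int p ^ n))"
      by (simp add: algebra_simps)
    also have "[(u * v) * (- m * int p) + int p * m = 1 * (- m * int p) + int p * m] (mod (int p ^ n))"
      using cong_scalar_right[OF v, of "- m * int p"] by (rule cong_add) simp
    finally show ?thesis
      unfolding c_pow_eq_iff by simp
  qed
  finally have "(c [^] (- m * v) \<otimes> y) [^] p = \<one>"
    by simp
  moreover have "c [^] (- m * v) \<otimes> y \<notin> generate G {c}"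
    using mult_notin[OF y] int_pow_mem_generate[OF c] by blast
  moreover have "c [^] (- m * v) \<otimes> y \<in> carrier G"
    using c y(1) by simp
  ultimately show False
    using pow_p_ne_one by blast
qed

text \<open>Here \<open>k = 1\<close> and the sum of the powers of \<open>k\<close> is \<open>p\<close> itself, so \<open>y ^ p\<close> cannot be a \<open>p\<close>-th power in
  \<open>\<langle>c\<rangle>\<close>. Hence \<open>y ^ p\<close> generates \<open>\<langle>c\<rangle>\<close>: an abelian extension is again cyclic.\<close>

lemma generator_mem_if_commuting:
  assumes y: "y \<in> carrier G" "y \<notin> generate G {c}" "y [^] p \<in> generate G {c}"
    and comm: "y \<otimes> c = c \<otimes> y"
  shows "c \<in> generate G {y}"
proof -
  obtain m :: int where m: "y [^] p = c [^] m"
    using y(3) c mem_generate_singleton_iff by blast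
  have "\<not> int p dvd m"
  proof
    assume "int p dvd m"
    then obtain m' where "m = int p * m'" ..
    moreover have "\<not> int p dvd 1"
      using p by (auto dest: prime_gt_1_nat)
    ultimately show False
      using no_complement[of y m' 1 1] m y comm c by simp
  qed
  then show ?thesis
    using generator_mem_if_coprime y(1) m by blast
qed

lemma generator_commutes:
  assumes "y \<in> carrier G" "c \<in> generate G {y}"
  shows "y \<otimes> c = c \<otimes> y"
proof -
  obtain k :: int where "c = y [^] k"
    using assms mem_generate_singleton_iff by blast
  then show ?thesis
    using assms(1) by (metis int_pow_1 int_pow_mult add.commute)
qed

text \<open>As \<open>y\<close> commutes with \<open>y\<^sup>2 = c ^ m\<close>, the order \<open>2 ^ n\<close> of \<open>c\<close> divides \<open>m (k - 1)\<close>. But \<open>k - 1\<close> is twice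
  an odd number, so \<open>y\<^sup>2\<close> has order at most \<open>2\<close>, and \<open>\<langle>c\<rangle>\<close> has only one involution.\<close>

lemma square_eq_involution:
  assumes p2: "p = 2" and y: "y \<in> carrier G" "y \<notin> generate G {c}" "y [^] p \<in> generate G {c}"
    and conj: "y \<otimes> c = c [^] (k::int) \<otimes> y" and k: "4 dvd k + 1"
    and "n \<ge> 1"
  shows "y [^] p = c [^] ((2::int) ^ (n - 1))"
proof -
  obtain m :: int where m: "y [^] p = c [^] m"
    using y(3) c mem_generate_singleton_iff by blast
  have N: "(2::int) ^ n = 2 * 2 ^ (n - 1)"
    using \<open>n \<ge> 1\<close> by (simp flip: power_Suc)
  have "c [^] (m + 0) \<otimes> y = c [^] (m * k) \<otimes> y"
  proof -
    have "c [^] m \<otimes> y = y \<otimes> c [^] m"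
      by (simp add: y(1) p2 numeral_2_eq_2 m_assoc flip: m)
    then show ?thesis
      using conj_int_pow[OF c y(1) conj] by simp
  qed
  then have "[m = m * k] (mod (2 ^ n))"
    using c y(1) by (simp add: c_pow_eq_iff p2)
  then have dvd: "2 ^ n dvd m * (k - 1)"
    by (metis cong_iff_dvd_diff cong_sym mult.right_neutral right_diff_distrib)
  obtain t where t: "k + 1 = 4 * t"
    using k ..
  then have "k - 1 = 2 * (2 * t - 1)"
    by simp
  then have "m * (k - 1) = 2 * m * (2 * t - 1)"
    by simp
  moreover have "coprime ((2::int) ^ n) (2 * t - 1)"
    by (simp add: coprime_left_2_iff_odd)
  ultimately have "2 ^ n dvd 2 * m"
    using dvd by (metis coprime_dvd_mult_left_iff)
  then obtain q where q: "m = 2 ^ (n - 1) * q"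
    unfolding N by (auto simp: dvd_def)
  have "c [^] m \<noteq> c [^] (0::int)"
    using pow_p_ne_one[OF y(1,2)] m by simp
  then have "\<not> [m = 0] (mod (2 ^ n))"
    using c_pow_eq_iff[of m 0] by (simp add: p2)
  then have "odd q"
    unfolding q N by (auto simp: cong_0_iff elim!: evenE)
  then obtain r where "q = 2 * r + 1"
    by (metis oddE)
  then have "[m = 2 ^ (n - 1)] (mod (2 ^ n))"
    unfolding q N by (simp add: cong_iff_dvd_diff algebra_simps)
  then show ?thesis
    unfolding m c_pow_eq_iff unfolding p2 by simp
qed

text \<open>Since \<open>y ^ p\<close> commutes with \<open>c\<close>, Fermat gives \<open>k \<equiv> 1\<close> modulo \<open>p\<close>. For odd \<open>p\<close> the sum of the powers of
  \<open>k\<close> is then \<open>p\<close> times a number prime to \<open>p\<close>, which is impossible. For \<open>p = 2\<close> the same argument leaves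
  only \<open>k \<equiv> 3\<close> modulo \<open>4\<close>. In this case both \<open>y\<close> and \<open>c y\<close> square to the involution of \<open>\<langle>c\<rangle>\<close>; as
  \<open>(c y)\<^sup>2 = c ^ (1 + k) y\<^sup>2\<close>, this forces \<open>c ^ k = c ^ (- 1)\<close>.\<close>

lemma noncommuting_extension:
  assumes y: "y \<in> carrier G" "y \<notin> generate G {c}" "y [^] p \<in> generate G {c}"
    and conj: "y \<otimes> c = c [^] (k::int) \<otimes> y" and ne: "y \<otimes> c \<noteq> c \<otimes> y"
  shows "p = 2" "n \<ge> 2" "y \<otimes> c = inv c \<otimes> y" "y [^] (2::nat) = c [^] ((2::int) ^ (n - 1))"
proof -
  obtain m :: int where m: "y [^] p = c [^] m"
    using y(3) c mem_generate_singleton_iff by blast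
  have "int p dvd m"
    using generator_mem_if_coprime[OF y(1) m] generator_commutes[OF y(1)] ne by blast
  then obtain m' where m': "y [^] p = c [^] (int p * m')"
    using m by (auto elim!: dvdE)
  have "\<not> [k = 1] (mod (int p ^ n))"
    using ne conj c_pow_eq_iff[of k 1] c by auto
  then have "n \<ge> 1"
    by (cases n) auto
  have "c [^] (1 * k ^ p) \<otimes> y [^] p = y [^] p \<otimes> c [^] (1::int)"
    by (rule nat_pow_conj_int_pow[OF c y(1) conj, symmetric])
  also have "\<dots> = c [^] (1::int) \<otimes> y [^] p"
    unfolding m using c by (simp flip: int_pow_mult) (metis add.commute int_pow_1 int_pow_mult)
  finally have "[k ^ p = 1] (mod (int p ^ n))"
    using c y(1) c_pow_eq_iff[of "k ^ p" 1] by simp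
  then have "[k ^ p = 1] (mod int p)"
    by (rule cong_dvd_modulus) (use \<open>n \<ge> 1\<close> in simp)
  moreover have "[k ^ p = k] (mod int p)"
  proof (cases "int p dvd k")
    case True
    then show ?thesis
      using p by (metis cong_0_iff cong_sym cong_trans dvd_power prime_gt_0_nat dvd_trans)
  next
    case False
    have "[nat (k mod int p) ^ (p - 1) = 1] (mod p)"
    proof (rule fermat_theorem[OF p])
      show "\<not> p dvd nat (k mod int p)"
        using False p prime_gt_0_nat[OF p]
        by (metis dvd_mod_iff dvd_refl int_dvd_int_iff nat_0_le of_nat_0_less_iff pos_mod_sign)
    qed
    then have "[int (nat (k mod int p)) ^ (p - 1) = 1] (mod int p)"
      by (metis cong_int_iff of_nat_1 of_nat_power)
    then have "[(k mod int p) ^ (p - 1) = 1] (mod int p)"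
      using prime_gt_0_nat[OF p] by simp
    then have "[k ^ (p - 1) = 1] (mod int p)"
      by (simp add: cong_def power_mod)
    then have "[k ^ (p - 1) * k = 1 * k] (mod int p)"
      by (rule cong_scalar_right)
    then show ?thesis
      using prime_gt_0_nat[OF p] by (simp flip: power_Suc2)
  qed
  ultimately have k1: "[k = 1] (mod int p)"
    by (metis cong_sym cong_trans)
  show p2: "p = 2"
  proof (rule ccontr)
    assume "p \<noteq> 2"
    then have "odd p"
      using p by (metis prime_odd_nat prime_ge_2_nat le_neq_implies_less)
    then obtain r where "(\<Sum>i<p. k ^ i) = int p + (int p)\<^sup>2 * r"
      using geometric_sum_cong_prime_square[OF _ k1] by (metis cong_iff_lin cong_sym)
    then have "(\<Sum>i<p. k ^ i) = int p * (1 + int p * r)"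
      by (simp add: power2_eq_square algebra_simps)
    then have "int p dvd 1 + int p * r"
      using no_complement[OF y(1,2) m' conj] by blast
    then have "int p dvd 1"
      by (metis dvd_add_times_triv_right_iff mult.commute)
    then show False
      using prime_gt_1_nat[OF p] by simp
  qed
  have "even (k + 1)"
    using k1 p2 by (simp add: cong_iff_dvd_diff)
  then obtain u where u: "k + 1 = 2 * u" ..
  have "(\<Sum>i<p. k ^ i) = int p * u"
    using u p2 by (simp add: numeral_2_eq_2)
  then have k4: "4 dvd k + 1"
    using no_complement[OF y(1,2) m' conj] u p2 by auto
  show "n \<ge> 2"
    using \<open>n \<ge> 1\<close> \<open>\<not> [k = 1] (mod (int p ^ n))\<close> k1 by (cases "n = 1") auto
  note sq = square_eq_involution[OF p2 _ _ _ _ k4 \<open>n \<ge> 1\<close>]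
  have y2: "y [^] p = c [^] ((2::int) ^ (n - 1))"
    using sq y conj by blast
  then show "y [^] (2::nat) = c [^] ((2::int) ^ (n - 1))"
    using p2 by simp
  have cy2: "(c \<otimes> y) [^] p = c [^] (k + 1) \<otimes> y [^] p"
    using nat_pow_mult_conj[OF c y(1) conj, of 1 p] c p2 by (simp add: numeral_2_eq_2 add.commute)
  have "(c \<otimes> y) [^] p = c [^] ((2::int) ^ (n - 1))"
  proof (rule sq)
    show "c \<otimes> y \<in> carrier G"
      using c y(1) by simp
    show "c \<otimes> y \<notin> generate G {c}"
      by (rule mult_notin[OF y(1,2)]) (simp add: generate.incl)
    show "(c \<otimes> y) [^] p \<in> generate G {c}"
      unfolding cy2 y2 using c by (simp add: int_pow_mem_generate flip: int_pow_mult)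
    have "c \<otimes> c [^] k = c [^] k \<otimes> c"
      using c by (metis add.commute int_pow_1 int_pow_mult)
    then show "c \<otimes> y \<otimes> c = c [^] k \<otimes> (c \<otimes> y)"
      using c y(1) conj by (simp add: m_assoc) (simp flip: m_assoc)
  qed
  then have "c [^] (k + 1) = \<one>"
    using cy2 y2 c by simp
  then have "c [^] k = inv c"
    using c by (simp add: int_pow_mult inv_equality)
  then show "y \<otimes> c = inv c \<otimes> y"
    using conj by simp
qed

end


section \<open>Groups of prime power order with a smallest nontrivial subgroup\<close>

text \<open>Such a \<open>z\<close> exists exactly if there is a smallest nontrivial subgroup, which \<open>z\<close> then generates.\<close>

definition common_element :: "('a, 'b) monoid_scheme \<Rightarrow> 'a \<Rightarrow> bool" where
  "common_element G z \<longleftrightarrow>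
     z \<in> carrier G \<and> z \<noteq> \<one>\<^bsub>G\<^esub> \<and> (\<forall>x\<in>carrier G. x \<noteq> \<one>\<^bsub>G\<^esub> \<longrightarrow> z \<in> generate G {x})"

text \<open>The relations of a generalized quaternion group of order \<open>2 ^ (n + 1)\<close>, together with the facts about
  orders and generation that make them a complete description of the group.\<close>

locale quaternion_generators = group G for G (structure) +
  fixes n :: nat and c b
  assumes c: "c \<in> carrier G" and b: "b \<in> carrier G" and n: "n \<ge> 2"
    and ord_c: "ord c = 2 ^ n" and b_notin: "b \<notin> generate G {c}"
    and b_square: "b [^] (2::nat) = c [^] ((2::nat) ^ (n - 1))"
    and b_inverts: "b \<otimes> c = inv c \<otimes> b"
    and carrier_subset: "carrier G \<subseteq> generate G {c} \<union> (generate G {c} #> b)"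

context group
begin

lemma cyclic_extension_if_common_element:
  assumes "prime p" "common_element G z" "c \<in> carrier G" "c \<noteq> \<one>" "ord c = p ^ n"
  shows "cyclic_extension G p n c"
proof unfold_locales
  fix x assume x: "x \<in> carrier G" "x \<notin> generate G {c}"
  show "x [^] p \<noteq> \<one>"
  proof
    assume "x [^] p = \<one>"
    have "x \<noteq> \<one>"
      using x(2) generate.one by blast
    then have "ord x = p"
      using \<open>prime p\<close> \<open>x [^] p = \<one>\<close> x(1) by (metis ord_eq_1 pow_eq_id prime_nat_iff)
    moreover have "z \<in> generate G {x}" "z \<in> generate G {c}" "z \<noteq> \<one>"
      using assms(2-4) x(1) \<open>x \<noteq> \<one>\<close> by (auto simp: common_element_def)
    ultimately have "x \<in> generate G {z}"
      using generator_of_prime_order[OF x(1)] \<open>prime p\<close> by blast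
    then show False
      using generate_singleton_trans[OF \<open>c \<in> carrier G\<close> \<open>z \<in> generate G {c}\<close>] x(2) by blast
  qed
qed (use assms in auto)

text \<open>Passing from \<open>y\<close> to this power reduces questions about arbitrary elements outside \<open>H\<close> to elements
  of order \<open>p\<close> modulo \<open>H\<close>.\<close>

lemma last_power_outside_subgroup:
  assumes "order G = p ^ r" "subgroup H G" "y \<in> carrier G" "y \<notin> H"
  obtains i :: nat where "y [^] (p ^ i) \<notin> H" "(y [^] (p ^ i)) [^] p \<in> H"
proof -
  define j where "j = (LEAST j. y [^] (p ^ j) \<in> H)"
  have "y [^] (p ^ r) \<in> H"
    using assms by (metis pow_order_eq_1 subgroup.one_closed)
  then have j: "y [^] (p ^ j) \<in> H"
    unfolding j_def by (rule LeastI)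
  then obtain i where i: "j = Suc i"
    using assms(3,4) by (cases j) auto
  have "y [^] (p ^ i) \<notin> H"
    using not_less_Least[of i "\<lambda>j. y [^] (p ^ j) \<in> H"] i unfolding j_def by simp
  moreover have "(y [^] (p ^ i)) [^] p \<in> H"
    using j assms(3) by (simp add: i nat_pow_pow mult.commute)
  ultimately show ?thesis
    using that by blast
qed

lemma conj_nat_pow:
  assumes "g \<in> carrier G" "x \<in> carrier G"
  shows "(g \<otimes> x \<otimes> inv g) [^] (k::nat) = g \<otimes> x [^] k \<otimes> inv g"
proof (induction k)
  case (Suc k)
  have "inv g \<otimes> (g \<otimes> w) = w" if "w \<in> carrier G" for w
    using assms that by (simp flip: m_assoc)
  then show ?case
    using assms Suc by (simp add: m_assoc)
qed (use assms in simp)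

text \<open>In a finite group these are the elements that generate a normal subgroup.\<close>

definition normal_generator :: "'a \<Rightarrow> bool" where
  "normal_generator c \<longleftrightarrow> c \<in> carrier G \<and> (\<forall>g\<in>carrier G. g \<otimes> c \<otimes> inv g \<in> generate G {c})"

lemma normal_generate_singleton:
  assumes fin: "finite (carrier G)" and "normal_generator c"
  shows "generate G {c} \<lhd> G"
proof -
  have c: "c \<in> carrier G" and conj: "\<And>g. g \<in> carrier G \<Longrightarrow> g \<otimes> c \<otimes> inv g \<in> generate G {c}"
    using assms(2) by (auto simp: normal_generator_def)
  have "g \<otimes> x \<otimes> inv g \<in> generate G {c}" if g: "g \<in> carrier G" and x: "x \<in> generate G {c}" for g x
  proof -
    obtain k :: nat where k: "x = c [^] k"
      using mem_generate_singleton_nat[OF fin c x] .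
    have "(g \<otimes> c \<otimes> inv g) [^] k \<in> generate G {g \<otimes> c \<otimes> inv g}"
      using g c by (simp add: nat_pow_mem_generate)
    then show ?thesis
      using generate_singleton_trans[OF c conj[OF g]] conj_nat_pow[OF g c] k by simp
  qed
  then show ?thesis
    using c by (simp add: normal_inv_iff subgroup_generate_singleton)
qed

text \<open>Let \<open>Z\<close> be the centralizer of \<open>c\<close> and \<open>C = \<langle>c\<rangle>\<close>. If \<open>C \<noteq> Z\<close>, the group \<open>G\<close>, acting by conjugation on the
  cosets of \<open>C\<close> in \<open>Z\<close>, fixes a coset \<open>C y\<close> other than \<open>C\<close>. A suitable power \<open>v\<close> of \<open>y\<close> still lies
  outside \<open>C\<close> but \<open>v ^ p \<in> C\<close>. Then \<open>C\<close> and \<open>v\<close> generate a normal abelian subgroup, which is cyclic with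
  generator \<open>v\<close> and larger than \<open>C\<close>, against the choice of \<open>c\<close>.\<close>

lemma maximal_normal_generator_self_centralizing:
  assumes fin: "finite (carrier G)" and p: "prime p" "order G = p ^ r" and z: "common_element G z"
    and norm: "normal_generator c" and max: "\<And>x. normal_generator x \<Longrightarrow> ord x \<le> ord c"
    and x: "x \<in> carrier G" "x \<otimes> c = c \<otimes> x"
  shows "x \<in> generate G {c}"
proof (rule ccontr)
  assume x_notin: "x \<notin> generate G {c}"
  let ?C = "generate G {c}"
  have c: "c \<in> carrier G"
    using norm by (simp add: normal_generator_def)
  interpret C: normal ?C G
    using fin norm by (rule normal_generate_singleton)
  have c_C: "c \<in> ?C"
    by (simp add: generate.incl)
  have C_c: "?C #> c = ?C"
    by (rule coset_join2[OF c C.subgroup_axioms c_C])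
  define Z where "Z = {g \<in> carrier G. g \<otimes> c = c \<otimes> g}"
  have Z_carrier: "y \<in> carrier G" if "y \<in> Z" for y
    using that by (simp add: Z_def)
  have Z: "subgroup Z G"
  proof (rule subgroupI)
    show "Z \<noteq> {}"
      using c by (auto simp: Z_def)
    show "inv a \<in> Z" if "a \<in> Z" for a
    proof -
      have a: "a \<in> carrier G" "a \<otimes> c = c \<otimes> a"
        using that by (auto simp: Z_def)
      have "inv a \<otimes> c = inv a \<otimes> (c \<otimes> a) \<otimes> inv a"
        using a(1) c by (simp add: m_assoc)
      also have "\<dots> = inv a \<otimes> (a \<otimes> c) \<otimes> inv a"
        by (simp only: a(2))
      also have "\<dots> = c \<otimes> inv a"
        using a(1) c by (simp flip: m_assoc)
      finally show ?thesis
        using a(1) by (simp add: Z_def)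
    qed
    show "a \<otimes> a' \<in> Z" if "a \<in> Z" "a' \<in> Z" for a a'
    proof -
      have a: "a \<in> carrier G" "a \<otimes> c = c \<otimes> a" and a': "a' \<in> carrier G" "a' \<otimes> c = c \<otimes> a'"
        using that by (auto simp: Z_def)
      have "a \<otimes> a' \<otimes> c = a \<otimes> c \<otimes> a'"
        using a(1) a' c by (simp add: m_assoc)
      then show ?thesis
        using a a'(1) c by (simp add: Z_def m_assoc)
    qed
  qed (auto simp: Z_def)
  have c_Z: "c \<in> Z"
    using c by (simp add: Z_def)
  have C_Z: "?C \<subseteq> Z"
    using Z c_Z by (simp add: generate_subgroup_incl)
  have Z_comm: "h \<otimes> y = y \<otimes> h" if h: "h \<in> ?C" and y: "y \<in> Z" for h y
  proof -
    obtain k :: nat where k: "h = c [^] k"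
      using mem_generate_singleton_nat[OF fin c h] .
    have "y \<in> carrier G" "y \<otimes> c = c [^] (1::int) \<otimes> y"
      using y c by (auto simp: Z_def)
    from conj_int_pow[OF c this, of "int k"] show ?thesis
      by (simp add: k int_pow_int)
  qed
  have conj_Z: "g \<otimes> y \<otimes> inv g \<in> Z" if g: "g \<in> carrier G" and y: "y \<in> Z" for g y
  proof -
    have y': "y \<in> carrier G"
      using y by (rule Z_carrier)
    have "inv g \<otimes> c \<otimes> g \<in> ?C"
      using C.inv_op_closed1[OF g generate.incl] by blast
    then have eq: "y \<otimes> (inv g \<otimes> c \<otimes> g) = (inv g \<otimes> c \<otimes> g) \<otimes> y"
      by (rule Z_comm[OF _ y, symmetric])
    have can: "g \<otimes> (inv g \<otimes> w) = w" if "w \<in> carrier G" for w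
      using g that by (simp flip: m_assoc)
    have "g \<otimes> y \<otimes> inv g \<otimes> c = g \<otimes> (y \<otimes> (inv g \<otimes> c \<otimes> g)) \<otimes> inv g"
      using g y' c by (simp add: m_assoc)
    also have "\<dots> = c \<otimes> (g \<otimes> y \<otimes> inv g)"
      unfolding eq using g y' c by (simp add: m_assoc can)
    finally show ?thesis
      using g y' by (simp add: Z_def)
  qed
  have "\<exists>y\<in>Z. y \<notin> ?C \<and> (\<forall>g\<in>carrier G. g \<otimes> y \<otimes> inv g \<in> ?C #> y)"
  proof -
    let ?A = "(\<lambda>y. ?C #> y) ` Z"
    interpret act: group_action G "{H. H \<subseteq> carrier G}" "\<lambda>g. \<lambda>H \<in> {H. H \<subseteq> carrier G}. g <# H #> inv g"
      by (rule action_by_conjugation_on_power_set)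
    have sub: "?C #> y \<subseteq> carrier G" if "y \<in> Z" for y
      using that by (intro r_coset_subset_G C.subset Z_carrier)
    have conj_coset: "g <# (?C #> y) #> inv g = ?C #> (g \<otimes> y \<otimes> inv g)"
      if g: "g \<in> carrier G" and y: "y \<in> Z" for g y
    proof -
      have y': "y \<in> carrier G"
        using y by (rule Z_carrier)
      have "g <# (?C #> y) = g <# ?C #> y"
        using g y' C.subset by (rule coset_assoc)
      also have "g <# ?C = ?C #> g"
        using C.coset_eq g by simp
      finally have "g <# (?C #> y) = ?C #> g #> y" .
      then show ?thesis
        using g y' C.subset by (simp add: coset_mult_assoc)
    qed
    have p_dvd: "p dvd card ?A"
    proof -
      have "card ?A * card ?C = card Z"
      proof -
        have sub: "subgroup ?C (G\<lparr>carrier := Z\<rparr>)"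
          using Z C_Z C.subgroup_axioms by (simp add: subgroup_incl)
        have "rcosets\<^bsub>G\<lparr>carrier := Z\<rparr>\<^esub> ?C = ?A"
          by (auto simp: RCOSETS_def r_coset_def)
        then show ?thesis
          using group.lagrange[OF subgroup_imp_group[OF Z] sub] by (simp add: order_def)
      qed
      moreover have "card Z dvd p ^ r"
        using lagrange[OF Z] p(2) by (metis dvd_triv_right)
      ultimately have "card ?A dvd p ^ r"
        by (metis dvd_mult_left)
      moreover have "card ?A \<noteq> 1"
      proof
        assume "card ?A = 1"
        then obtain B where "?A = {B}"
          by (rule card_1_singletonE)
        moreover have "?C #> x \<in> ?A" "?C #> c \<in> ?A"
          using x c_Z by (auto simp: Z_def)
        ultimately have "?C #> x = ?C #> c"
          by (metis singletonD)
        then have "?C #> x = ?C"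
          using C_c by simp
        then have "x \<in> ?C"
          by (rule coset_join1[OF _ x(1) C.subgroup_axioms])
        then show False
          using x_notin by simp
      qed
      ultimately show ?thesis
        using p(1) by (metis divides_primepow_nat dvd_power gr0I power_0)
    qed
    have sub_A: "?A \<subseteq> {H. H \<subseteq> carrier G}"
      using sub by blast
    have fin_A: "finite ?A"
      using fin by (simp add: Z_def)
    have A_closed: "(\<lambda>H \<in> {H. H \<subseteq> carrier G}. g <# H #> inv g) H \<in> ?A"
      if "g \<in> carrier G" "H \<in> ?A" for g H
    proof -
      obtain y where y: "y \<in> Z" "H = ?C #> y"
        using \<open>H \<in> ?A\<close> by blast
      then have "H \<in> {H. H \<subseteq> carrier G}"
        using sub by blast
      then show ?thesis
        using conj_coset[OF \<open>g \<in> carrier G\<close> y(1)] conj_Z[OF \<open>g \<in> carrier G\<close> y(1)] y(2) by simp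
    qed
    have C_A: "?C \<in> ?A"
      using c_Z C_c by (metis image_eqI)
    have C_fixed: "(\<lambda>H \<in> {H. H \<subseteq> carrier G}. g <# H #> inv g) ?C = ?C" if g: "g \<in> carrier G" for g
    proof -
      have "g <# ?C #> inv g = ?C #> g #> inv g"
        using C.coset_eq g by simp
      then show ?thesis
        using g C.subset by (simp add: coset_mult_assoc)
    qed
    have "\<exists>H\<in>?A - {?C}. \<forall>g\<in>carrier G. (\<lambda>H \<in> {H. H \<subseteq> carrier G}. g <# H #> inv g) H = H"
      by (rule act.fixed_point_of_prime_power_order[OF p sub_A fin_A p_dvd A_closed C_A C_fixed])
    then obtain H where H: "H \<in> ?A" "H \<noteq> ?C"
      and H_fixed: "\<forall>g\<in>carrier G. (\<lambda>H \<in> {H. H \<subseteq> carrier G}. g <# H #> inv g) H = H"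
      by blast
    then obtain y where y: "y \<in> Z" "H = ?C #> y"
      by blast
    have "y \<notin> ?C"
      using H(2) y coset_join2[OF _ C.subgroup_axioms] Z_carrier by blast
    moreover have "g \<otimes> y \<otimes> inv g \<in> ?C #> y" if g: "g \<in> carrier G" for g
    proof -
      have "?C #> (g \<otimes> y \<otimes> inv g) = ?C #> y"
        using bspec[OF H_fixed g] conj_coset[OF g y(1)] sub[OF y(1)] y(2) by simp
      moreover have "g \<otimes> y \<otimes> inv g \<in> ?C #> (g \<otimes> y \<otimes> inv g)"
        using g Z_carrier[OF y(1)] by (intro rcos_self C.subgroup_axioms) auto
      ultimately show ?thesis
        by simp
    qed
    ultimately show ?thesis
      using y(1) by blast
  qed
  then obtain y where y: "y \<in> Z" "y \<notin> ?C"
    and y_conj: "\<And>g. g \<in> carrier G \<Longrightarrow> g \<otimes> y \<otimes> inv g \<in> ?C #> y"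
    by blast
  obtain i where i: "y [^] (p ^ i) \<notin> ?C" "(y [^] (p ^ i)) [^] p \<in> ?C"
    using last_power_outside_subgroup[OF p(2) C.subgroup_axioms Z_carrier[OF y(1)] y(2)] by blast
  define v where "v = y [^] (p ^ i)"
  have v: "v \<in> carrier G" "v \<notin> ?C" "v [^] p \<in> ?C"
    using i Z_carrier[OF y(1)] by (auto simp: v_def)
  have "c \<otimes> v = v \<otimes> c"
  proof -
    have "v \<in> Z"
      using subgroup_int_pow_closed[OF Z y(1), of "int (p ^ i)"] by (simp add: v_def int_pow_int del: of_nat_power)
    then show ?thesis
      by (simp add: Z_def)
  qed
  have c_v: "c \<in> generate G {v}"
  proof (cases "c = \<one>")
    case True
    then show ?thesis
      by (simp add: generate.one)
  next
    case False
    have "ord c dvd p ^ r"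
      using ord_dvd_group_order[OF c] p(2) by simp
    then obtain n where "ord c = p ^ n"
      using p(1) by (metis divides_primepow_nat)
    then interpret cyclic_extension G p n c
      using cyclic_extension_if_common_element p(1) z c False by blast
    show ?thesis
      using generator_mem_if_commuting v \<open>c \<otimes> v = v \<otimes> c\<close> by simp
  qed
  have C_v: "?C \<subseteq> generate G {v}"
    using v(1) c_v by (rule generate_singleton_subset)
  have "normal_generator v"
    unfolding normal_generator_def
  proof (intro conjI ballI v(1))
    fix g assume g: "g \<in> carrier G"
    obtain h where h: "h \<in> ?C" "g \<otimes> y \<otimes> inv g = h \<otimes> y"
      using y_conj[OF g] by (auto simp: r_coset_def)
    have h': "h \<in> carrier G"
      using h(1) C.mem_carrier by blast
    have "g \<otimes> v \<otimes> inv g = (h \<otimes> y) [^] (p ^ i)"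
      using conj_nat_pow[OF g Z_carrier[OF y(1)]] h(2) by (simp add: v_def)
    also have "\<dots> = h [^] (p ^ i) \<otimes> v"
      using pow_mult_distrib[OF Z_comm[OF h(1) y(1)] h' Z_carrier[OF y(1)]] by (simp add: v_def)
    finally have "g \<otimes> v \<otimes> inv g = h [^] (p ^ i) \<otimes> v" .
    moreover have "h [^] (p ^ i) \<in> generate G {v}"
      using C_v h(1) nat_pow_mem_generate[OF h'] generate_singleton_trans[OF v(1)] by blast
    ultimately show "g \<otimes> v \<otimes> inv g \<in> generate G {v}"
      using v(1) by (simp add: generate.incl subgroup.m_closed[OF subgroup_generate_singleton])
  qed
  then have "ord v \<le> ord c"
    by (rule max)
  moreover have "finite (generate G {v})"
    using fin v(1) by (meson finite_subset generate_incl insert_subset empty_subsetI)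
  then have "card ?C < card (generate G {v})"
  proof (rule psubset_card_mono)
    have "v \<in> generate G {v}"
      by (simp add: generate.incl)
    then show "?C \<subset> generate G {v}"
      using C_v v(2) by blast
  qed
  ultimately show False
    using generate_pow_card[OF c] generate_pow_card[OF v(1)] by simp
qed

text \<open>Take \<open>C = \<langle>c\<rangle>\<close> cyclic, normal and of maximal order, so that \<open>C\<close> is its own centralizer. An element \<open>w\<close>
  outside \<open>C\<close> has a power \<open>v\<close> outside \<open>C\<close> with \<open>v ^ p \<in> C\<close>; as \<open>v\<close> does not commute with \<open>c\<close>, it inverts
  \<open>c\<close>, and \<open>p = 2\<close>. Because \<open>4\<close> divides the order of \<open>c\<close> and \<open>- 1\<close> is not a square modulo
  \<open>4\<close>, no square inverts \<open>c\<close>, and hence \<open>v = w\<close>.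
  So all elements outside \<open>C\<close> invert \<open>c\<close>; the product of any two of them centralizes \<open>c\<close> and lies in
  \<open>C\<close>, which makes the index of \<open>C\<close> equal to \<open>2\<close>.\<close>

theorem cyclic_or_quaternion:
  assumes fin: "finite (carrier G)" and pgrp: "prime p" "order G = p ^ r" and z: "common_element G z"
  obtains (cyclic) c where "c \<in> carrier G" "carrier G = generate G {c}"
  | (quaternion) n c b where "quaternion_generators G n c b"
proof -
  have "normal_generator \<one>"
    by (simp add: normal_generator_def generate.one)
  then obtain c where norm: "normal_generator c" and max: "\<And>x. normal_generator x \<Longrightarrow> ord x \<le> ord c"
    using ex_has_greatest_nat[of normal_generator \<one> ord "Suc (order G)"] ord_le_group_order[OF fin]
    unfolding normal_generator_def less_Suc_eq_le by metis
  let ?C = "generate G {c}"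
  have c: "c \<in> carrier G"
    using norm by (simp add: normal_generator_def)
  interpret C: normal ?C G
    using fin norm by (rule normal_generate_singleton)
  have central: "x \<in> ?C" if "x \<in> carrier G" "x \<otimes> c = c \<otimes> x" for x
    using maximal_normal_generator_self_centralizing[OF fin pgrp z norm max that] .
  show ?thesis
  proof (cases "carrier G = ?C")
    case True
    then show ?thesis
      using c cyclic by blast
  next
    case False
    then obtain b where b: "b \<in> carrier G" "b \<notin> ?C"
      using C.subset by blast
    have "c \<noteq> \<one>"
      using central[OF b(1)] b by auto
    have "ord c dvd p ^ r"
      using ord_dvd_group_order[OF c] pgrp(2) by simp
    then obtain n where ord_c: "ord c = p ^ n"
      using pgrp(1) by (metis divides_primepow_nat)
    interpret cyclic_extension G p n c
      using cyclic_extension_if_common_element pgrp(1) z c \<open>c \<noteq> \<one>\<close> ord_c by blast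
    have conj: "\<exists>k::int. w \<otimes> c = c [^] k \<otimes> w" if w: "w \<in> carrier G" for w
    proof -
      have "w \<otimes> c \<otimes> inv w \<in> ?C"
        using norm w by (simp add: normal_generator_def)
      then obtain k :: int where "w \<otimes> c \<otimes> inv w = c [^] k"
        using c mem_generate_singleton_iff by blast
      then have "w \<otimes> c = c [^] k \<otimes> w"
        using w c by (metis int_pow_closed inv_solve_right m_closed)
      then show ?thesis ..
    qed
    have outside: "p = 2" "n \<ge> 2" "w \<otimes> c = inv c \<otimes> w" "w [^] (2::nat) = c [^] ((2::int) ^ (n - 1))"
      if w: "w \<in> carrier G" "w \<notin> ?C" for w
    proof -
      obtain i where i: "w [^] (p ^ i) \<notin> ?C" "(w [^] (p ^ i)) [^] p \<in> ?C"
        using last_power_outside_subgroup[OF pgrp(2) C.subgroup_axioms w] by blast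
      let ?v = "w [^] (p ^ i)"
      have "?v \<in> carrier G"
        using w(1) by simp
      then obtain k :: int where k: "?v \<otimes> c = c [^] k \<otimes> ?v"
        using conj by blast
      have "?v \<otimes> c \<noteq> c \<otimes> ?v"
        using central \<open>?v \<in> carrier G\<close> i(1) by blast
      note v = noncommuting_extension[OF \<open>?v \<in> carrier G\<close> i k this]
      show "p = 2" "n \<ge> 2"
        using v by auto
      have "i = 0"
      proof (rule ccontr)
        assume "i \<noteq> 0"
        define u where "u = w [^] (2 ^ (i - 1) :: nat)"
        have u: "u \<in> carrier G" "u [^] (2::nat) = ?v"
          using w(1) \<open>i \<noteq> 0\<close> \<open>p = 2\<close> by (auto simp: u_def nat_pow_pow simp flip: power_Suc2)
        obtain l :: int where l: "u \<otimes> c = c [^] l \<otimes> u"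
          using conj u(1) by blast
        have "c [^] (1 * l ^ 2) \<otimes> ?v = ?v \<otimes> c [^] (1::int)"
          using nat_pow_conj_int_pow[OF c u(1) l, of 2 1] u(2) by simp
        also have "\<dots> = c [^] (- 1 :: int) \<otimes> ?v"
          using v(3) c by (simp add: int_pow_neg)
        finally have "c [^] (1 * l ^ 2) = c [^] (- 1 :: int)"
          using c \<open>?v \<in> carrier G\<close> by (metis int_pow_closed right_cancel)
        \<comment> \<open>The element \<open>u\<close> conjugates \<open>c\<close> to \<open>c ^ l\<close>, hence its square \<open>w ^ (2 ^ i)\<close> conjugates \<open>c\<close> to \<open>c ^ (l\<^sup>2)\<close>.\<close>
        then have "[l ^ 2 = - 1] (mod (2 ^ n))"
          by (simp add: c_pow_eq_iff \<open>p = 2\<close>)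
        moreover have "(4::int) dvd 2 ^ n"
          using le_imp_power_dvd[OF \<open>n \<ge> 2\<close>, of "2::int"] by simp
        ultimately have "[l ^ 2 = - 1] (mod 4)"
          by (rule cong_dvd_modulus)
        moreover have "l mod 4 = 0 \<or> l mod 4 = 1 \<or> l mod 4 = 2 \<or> l mod 4 = 3"
          by presburger
        moreover have "l ^ 2 mod 4 = (l mod 4) ^ 2 mod 4"
          by (simp add: power_mod)
        ultimately show False
          by (auto simp: cong_def)
      qed
      then show "w \<otimes> c = inv c \<otimes> w" "w [^] (2::nat) = c [^] ((2::int) ^ (n - 1))"
        using v w(1) by auto
    qed
    note b' = outside[OF b]
    have sq: "b [^] (2::nat) \<in> ?C"
      using b'(4) c by (simp add: int_pow_mem_generate)
    \<comment> \<open>Both \<open>w\<close> and \<open>b\<close> invert \<open>c\<close>, so \<open>w b\<close> centralizes it.\<close>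
    have "w \<in> ?C #> b" if w: "w \<in> carrier G" "w \<notin> ?C" for w
    proof -
      have "w \<otimes> b \<otimes> c = w \<otimes> inv c \<otimes> b"
        using b'(3) w(1) b(1) c by (simp add: m_assoc)
      also have "w \<otimes> inv c = c \<otimes> w"
      proof -
        have "c \<otimes> w \<otimes> c = c \<otimes> (inv c \<otimes> w)"
          using outside(3)[OF w] w(1) c by (simp add: m_assoc)
        also have "\<dots> = w"
          using w(1) c by (simp flip: m_assoc)
        finally show ?thesis
          using inv_solve_right[of "c \<otimes> w" w c] w(1) c by simp
      qed
      finally have "w \<otimes> b \<in> ?C"
        using central[of "w \<otimes> b"] w(1) b(1) c by (simp add: m_assoc)
      then have "w \<otimes> b \<otimes> inv (b [^] (2::nat)) \<in> ?C"
        using sq by blast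
      moreover have "w = w \<otimes> b \<otimes> inv (b [^] (2::nat)) \<otimes> b"
        using w(1) b(1) by (simp add: numeral_2_eq_2 m_assoc inv_mult_group)
      ultimately show ?thesis
        by (auto simp: r_coset_def)
    qed
    then have "carrier G \<subseteq> ?C \<union> (?C #> b)"
      by blast
    moreover have "b [^] (2::nat) = c [^] ((2::nat) ^ (n - 1))"
      using b'(4) int_pow_int[of G c "2 ^ (n - 1)"] by simp
    moreover have "ord c = 2 ^ n"
      using ord_c b'(1) by simp
    ultimately have "quaternion_generators G n c b"
      by (intro quaternion_generators.intro quaternion_generators_axioms.intro is_group b b'(2,3) c)
    then show ?thesis
      by (rule quaternion)
  qed
qed

end


section \<open>Cyclic subgroups and the intersection graph\<close>

context group
begin

text \<open>Write \<open>x = c ^ (p ^ i u)\<close> with \<open>u\<close> prime to \<open>p\<close>; the factor \<open>u\<close> does not change the subgroup.\<close>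

lemma generate_prime_power_order:
  assumes p: "prime p" and c: "c \<in> carrier G" "ord c = p ^ n" and x: "x \<in> generate G {c}" "x \<noteq> \<one>"
  obtains i where "i < n" "generate G {x} = generate G {c [^] (p ^ i)}"
proof -
  obtain k :: int where k: "x = c [^] k"
    using x(1) c(1) mem_generate_singleton_iff by blast
  have ndvd: "\<not> int p ^ n dvd k"
    using x(2) int_pow_eq_id[OF c(1)] by (simp add: k c(2))
  then have "k \<noteq> 0"
    by auto
  moreover have "\<not> is_unit (int p)"
    using prime_gt_1_nat[OF p] by simp
  ultimately obtain u where u: "k = int p ^ multiplicity (int p) k * u" "\<not> int p dvd u"
    using multiplicity_decompose' by blast
  define i where "i = multiplicity (int p) k"
  have "i < n"
  proof (rule ccontr)
    assume "\<not> i < n"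
    then have "int p ^ n dvd int p ^ i"
      by (simp add: le_imp_power_dvd)
    then show False
      using ndvd u(1) by (metis dvd_mult2 i_def)
  qed
  let ?y = "c [^] (p ^ i)"
  have y: "?y \<in> carrier G" "x = ?y [^] u"
    using c(1) u(1) by (auto simp: k int_pow_pow i_def simp flip: int_pow_int)
  have "ord ?y = p ^ (n - i)"
    using \<open>i < n\<close> prime_gt_0_nat[OF p]
    by (simp add: ord_pow c le_imp_power_dvd power_diff)
  moreover have "coprime (int p) u"
    using prime_imp_coprime[of "int p" u] p u(2) by simp
  ultimately have "coprime u (int (ord ?y))"
    by (simp add: coprime_commute)
  then have "generate G {x} = generate G {?y}"
    using generate_int_pow_coprime[OF y(1)] y(2) by simp
  then show ?thesis
    using that \<open>i < n\<close> by blast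
qed

lemma pow_mem_generate_pow:
  assumes "c \<in> carrier G" "i \<le> j"
  shows "c [^] (p ^ j :: nat) \<in> generate G {c [^] (p ^ i :: nat)}"
proof -
  have "c [^] (p ^ j) = (c [^] (p ^ i)) [^] (p ^ (j - i))"
    using assms by (simp add: nat_pow_pow flip: power_add)
  then show ?thesis
    using assms(1) nat_pow_mem_generate[of "c [^] (p ^ i)"] by simp
qed

lemma generates_of_prime_power_order:
  assumes p: "prime p" and c: "c \<in> carrier G" "ord c = p ^ n"
  shows "(\<lambda>x. generate G {x}) ` (generate G {c} - {\<one>}) = (\<lambda>i. generate G {c [^] (p ^ i)}) ` {..<n}"
    (is "?L = ?R")
proof
  show "?L \<subseteq> ?R"
    using generate_prime_power_order[OF p c] by (fastforce simp: image_iff)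
  show "?R \<subseteq> ?L"
  proof
    fix H assume "H \<in> ?R"
    then obtain i where i: "i < n" "H = generate G {c [^] (p ^ i)}"
      by blast
    have "\<not> p ^ n dvd p ^ i"
      using i(1) prime_gt_1_nat[OF p] by (meson nat_dvd_not_less power_strict_increasing_iff power_not_zero not_gr_zero zero_less_power less_trans zero_less_one)
    then have "c [^] (p ^ i) \<noteq> \<one>"
      using pow_eq_id[OF c(1)] c(2) by simp
    then show "H \<in> ?L"
      using i(2) nat_pow_mem_generate[OF c(1)] by blast
  qed
qed

lemma inj_on_generate_prime_power:
  assumes p: "prime p" and c: "c \<in> carrier G" "ord c = p ^ n"
  shows "inj_on (\<lambda>i. generate G {c [^] (p ^ i)}) {..<n}"
proof (rule inj_onI)
  fix i j assume ij: "i \<in> {..<n}" "j \<in> {..<n}"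
    and eq: "generate G {c [^] (p ^ i)} = generate G {c [^] (p ^ j)}"
  have "ord (c [^] (p ^ k)) = p ^ (n - k)" if "k < n" for k
    using that prime_gt_0_nat[OF p] by (simp add: ord_pow c le_imp_power_dvd power_diff)
  then have "p ^ (n - i) = p ^ (n - j)"
    using ij eq c(1) generate_pow_card[of "c [^] (p ^ i)"] generate_pow_card[of "c [^] (p ^ j)"] by simp
  then show "i = j"
    using ij prime_gt_1_nat[OF p] by (simp add: power_inject_exp)
qed

lemma proper_cyclic_subgroups_eq:
  "proper_cyclic_subgroups G = (\<lambda>x. generate G {x}) ` (carrier G - {\<one>}) - {carrier G}"
proof (intro equalityI subsetI)
  fix H assume "H \<in> proper_cyclic_subgroups G"
  then have H: "subgroup H G" "cyclic_group (G\<lparr>carrier := H\<rparr>)" "H \<noteq> carrier G" "H \<noteq> {\<one>}"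
    by (auto simp: proper_cyclic_subgroups_def)
  obtain x where x: "x \<in> H" "H = range (\<lambda>k::int. x [^]\<^bsub>G\<lparr>carrier := H\<rparr>\<^esub> k)"
    using group.cyclic_group[OF subgroup_imp_group[OF H(1)]] H(2) by auto
  have xG: "x \<in> carrier G"
    by (rule subgroup.mem_carrier[OF H(1) x(1)])
  have "H = generate G {x}"
    unfolding generate_pow[OF xG] using x(2) int_pow_consistent[OF H(1) x(1)] by auto
  moreover from this have "x \<noteq> \<one>"
    using H(4) generate_one by auto
  ultimately show "H \<in> (\<lambda>x. generate G {x}) ` (carrier G - {\<one>}) - {carrier G}"
    using xG H(3) by blast
next
  fix H assume "H \<in> (\<lambda>x. generate G {x}) ` (carrier G - {\<one>}) - {carrier G}"
  then obtain x where x: "x \<in> carrier G" "x \<noteq> \<one>" and H: "H = generate G {x}" "H \<noteq> carrier G"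
    by blast
  have "x \<in> H"
    by (simp add: H(1) generate.incl)
  moreover have "cyclic_group (G\<lparr>carrier := H\<rparr>)"
    using cyclic_group_generated[of x] x(1) by (simp add: subgroup_generated_def H(1))
  ultimately show "H \<in> proper_cyclic_subgroups G"
    using H x subgroup_generate_singleton by (auto simp: proper_cyclic_subgroups_def)
qed

text \<open>All vertices contain \<open>z\<close>.\<close>

lemma complete_digraph_if_common_element:
  assumes "finite (carrier G)" "common_element G z"
  shows "complete_digraph (card (proper_cyclic_subgroups G)) (cyclic_intersection_graph G)"
proof -
  let ?V = "proper_cyclic_subgroups G"
  have z: "z \<in> H" if "H \<in> ?V" for H
    using that assms(2) by (auto simp: proper_cyclic_subgroups_eq common_element_def)
  then have "H \<inter> K \<noteq> {\<one>}" if "H \<in> ?V" "K \<in> ?V" for H K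
    using that assms(2) by (auto simp: common_element_def)
  moreover have "finite ?V"
    using assms(1) by (simp add: proper_cyclic_subgroups_eq)
  ultimately show ?thesis
    unfolding cyclic_intersection_graph_def complete_digraph_pair_def by auto
qed

lemma common_element_if_iso:
  assumes "group H" "G \<cong> H" "common_element H z"
  shows "\<exists>z. common_element G z"
proof -
  obtain h where h: "h \<in> iso H G"
    using iso_sym[OF assms(2)] by (auto simp: is_iso_def)
  interpret H: group H
    by fact
  interpret group_hom H G h
    using h by (unfold_locales) (simp add: iso_def)
  have inj: "inj_on h (carrier H)" and surj: "h ` carrier H = carrier G"
    using h by (auto simp: iso_def bij_betw_def)
  have z: "z \<in> carrier H" "z \<noteq> \<one>\<^bsub>H\<^esub>"
    using assms(3) by (auto simp: common_element_def)
  have "h z \<in> generate G {x}" if x: "x \<in> carrier G" "x \<noteq> \<one>" for x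
  proof -
    obtain y where y: "y \<in> carrier H" "x = h y"
      using x(1) surj by blast
    then have "z \<in> generate H {y}"
      using assms(3) x(2) by (auto simp: common_element_def)
    then obtain k :: int where "z = y [^]\<^bsub>H\<^esub> k"
      using H.mem_generate_singleton_iff y(1) by blast
    then show ?thesis
      using y by (simp add: hom_int_pow int_pow_mem_generate)
  qed
  moreover have "h z \<noteq> \<one>"
    using z inj inj_onD[OF inj, of z "\<one>\<^bsub>H\<^esub>"] by auto
  moreover have "h z \<in> carrier G"
    using z(1) by simp
  ultimately show ?thesis
    unfolding common_element_def by blast
qed

lemma common_element_cyclic:
  assumes p: "prime p" and c: "c \<in> carrier G" "ord c = p ^ n" "carrier G = generate G {c}" and "n \<ge> 1"
  shows "common_element G (c [^] (p ^ (n - 1)))"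
  unfolding common_element_def
proof (intro conjI ballI impI)
  show "c [^] (p ^ (n - 1)) \<in> carrier G"
    using c(1) by (rule nat_pow_closed)
  have "c [^] (p ^ (n - 1)) \<in> generate G {c [^] (p ^ (n - 1))}"
    by (simp add: generate.incl)
  have "ord (c [^] (p ^ (n - 1))) = p"
    using \<open>n \<ge> 1\<close> prime_gt_0_nat[OF p] by (cases n) (simp_all add: ord_pow c(1,2) le_imp_power_dvd)
  then show "c [^] (p ^ (n - 1)) \<noteq> \<one>"
    using prime_gt_1_nat[OF p] by auto
  fix x assume "x \<in> carrier G" "x \<noteq> \<one>"
  then obtain i where "i < n" "generate G {x} = generate G {c [^] (p ^ i)}"
    using generate_prime_power_order[OF p c(1,2)] c(3) by metis
  then show "c [^] (p ^ (n - 1)) \<in> generate G {x}"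
    using pow_mem_generate_pow[OF c(1), of i "n - 1" p] by simp
qed

lemma card_proper_cyclic_subgroups_cyclic:
  assumes p: "prime p" and c: "c \<in> carrier G" "ord c = p ^ n" "carrier G = generate G {c}"
  shows "card (proper_cyclic_subgroups G) = n - 1"
proof (cases "n = 0")
  case True
  then have "c = \<one>"
    using c(1,2) ord_eq_1 by simp
  then show ?thesis
    using c(3) True by (simp add: proper_cyclic_subgroups_eq generate_one)
next
  case False
  let ?f = "\<lambda>i. generate G {c [^] (p ^ i)}"
  have "?f 0 = carrier G"
    using c by simp
  then have "proper_cyclic_subgroups G = ?f ` {..<n} - {?f 0}"
    using generates_of_prime_power_order[OF p c(1,2)] c(3) by (simp add: proper_cyclic_subgroups_eq)
  also have "card \<dots> = card (?f ` {..<n}) - 1"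
    by (rule card_Diff_singleton, rule imageI) (use False in simp)
  also have "card (?f ` {..<n}) = n"
    using card_image[OF inj_on_generate_prime_power[OF p c(1,2)]] by simp
  finally show ?thesis .
qed

lemma iso_integer_mod_group:
  assumes c: "c \<in> carrier G" "carrier G = generate G {c}" and "ord c > 0"
  shows "G \<cong> integer_mod_group (ord c)"
proof -
  let ?Z = "integer_mod_group (ord c)"
  let ?h = "\<lambda>k::int. c [^] k"
  have Z: "carrier ?Z = {0..<int (ord c)}"
    using assms(3) by (simp add: carrier_integer_mod_group)
  have mod: "c [^] (k mod int (ord c)) = c [^] k" for k
    by (simp add: int_pow_eq_iff_cong c(1) cong_def)
  have "?h \<in> hom ?Z G"
    using c(1) by (auto simp: hom_def mod int_pow_mult)
  moreover have "inj_on ?h (carrier ?Z)"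
    by (auto simp: Z inj_on_def int_pow_eq_iff_cong c(1) cong_def)
  moreover have "?h ` carrier ?Z = carrier G"
  proof -
    have "c [^] k \<in> ?h ` carrier ?Z" for k :: int
      using assms(3) by (intro image_eqI[of _ _ "k mod int (ord c)"]) (auto simp: Z mod)
    then show ?thesis
      unfolding c(2) generate_pow[OF c(1)] by auto
  qed
  ultimately have "?Z \<cong> G"
    by (auto simp: is_iso_def iso_def bij_betw_def)
  then show ?thesis
    by (rule group.iso_sym[OF group_integer_mod_group])
qed

end

lemma integer_mod_group_generator:
  assumes "m > 1"
  shows "1 \<in> carrier (integer_mod_group m)"
    and "carrier (integer_mod_group m) = generate (integer_mod_group m) {1}"
    and "group.ord (integer_mod_group m) 1 = m"
proof -
  interpret group "integer_mod_group m"
    by simp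
  show one: "1 \<in> carrier (integer_mod_group m)"
    using assms by simp
  show "carrier (integer_mod_group m) = generate (integer_mod_group m) {1}"
  proof
    show "carrier (integer_mod_group m) \<subseteq> generate (integer_mod_group m) {1}"
    proof
      fix k assume "k \<in> carrier (integer_mod_group m)"
      then have "k = 1 [^]\<^bsub>integer_mod_group m\<^esub> k"
        using assms by (simp add: int_pow_integer_mod_group carrier_integer_mod_group)
      then show "k \<in> generate (integer_mod_group m) {1}"
        using int_pow_mem_generate[OF one] by metis
    qed
    show "generate (integer_mod_group m) {1} \<subseteq> carrier (integer_mod_group m)"
      using one by (intro generate_incl) simp
  qed
  show "ord 1 = m"
    unfolding ord_unique[OF one] by (simp add: mod_eq_0_iff_dvd)
qed

section \<open>Cyclic subgroups of groups with quaternion generators\<close>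

context quaternion_generators
begin

lemma conj_b: "b \<otimes> c = c [^] (- 1 :: int) \<otimes> b"
  using b_inverts c by (simp add: int_pow_neg)

text \<open>In \<open>(c ^ j b)\<^sup>2\<close> the two factors \<open>c ^ j\<close> cancel because \<open>b\<close> inverts \<open>c\<close>; what is left is \<open>b\<^sup>2\<close>, the involution of
  \<open>\<langle>c\<rangle>\<close>.\<close>

lemma square_outside: "(c [^] (j::int) \<otimes> b) [^] (2::nat) = c [^] ((2::int) ^ (n - 1))"
proof -
  have "(\<Sum>i<2::nat. (- 1::int) ^ i) = 0"
    by (simp add: numeral_2_eq_2)
  then have "(c [^] j \<otimes> b) [^] (2::nat) = b [^] (2::nat)"
    using nat_pow_mult_conj[OF c b conj_b, of j 2] b by simp
  then show ?thesis
    using b_square int_pow_int[of G c "2 ^ (n - 1)"] by simp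
qed

lemma int_pow_mult_b_notin: "c [^] (j::int) \<otimes> b \<notin> generate G {c}"
proof
  assume "c [^] j \<otimes> b \<in> generate G {c}"
  then obtain k :: int where "c [^] j \<otimes> b = c [^] k"
    using c mem_generate_singleton_iff by blast
  then have "c [^] (- j) \<otimes> (c [^] j \<otimes> b) = c [^] (- j + k)"
    by (simp only: int_pow_mult[OF c])
  moreover have "c [^] (- j) \<otimes> (c [^] j \<otimes> b) = b"
    using c b by (simp flip: m_assoc int_pow_mult)
  ultimately have "b = c [^] (- j + k)"
    by simp
  then show False
    using b_notin int_pow_mem_generate[OF c] by metis
qed

lemma carrier_cases:
  assumes "x \<in> carrier G"
  obtains (inside) "x \<in> generate G {c}" | (outside) j :: int where "x = c [^] j \<otimes> b"
proof (cases "x \<in> generate G {c}")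
  case False
  then have "x \<in> generate G {c} #> b"
    using assms carrier_subset by blast
  then obtain h where h: "h \<in> generate G {c}" "x = h \<otimes> b"
    by (auto simp: r_coset_def)
  then obtain j :: int where "h = c [^] j"
    using c mem_generate_singleton_iff by blast
  then show ?thesis
    using h(2) outside by blast
qed (rule inside)

lemma card_carrier: "card (carrier G) = 2 ^ (n + 1)" and finite_carrier: "finite (carrier G)"
proof -
  let ?C = "generate G {c}"
  have C: "subgroup ?C G"
    using c by (rule subgroup_generate_singleton)
  have card_C: "card ?C = 2 ^ n"
    using generate_pow_card[OF c] ord_c by simp
  then have fin: "finite ?C"
    by (metis card.infinite power_not_zero zero_neq_numeral)
  have "?C #> b \<in> rcosets ?C"
    using b by (auto simp: RCOSETS_def)
  then have "card (?C #> b) = card ?C"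
    using card_cosets_equal[OF _ subgroup.subset[OF C]] by (metis bij_betw_same_card)
  have eq: "carrier G = ?C \<union> (?C #> b)"
    using carrier_subset subgroup.subset[OF C] b r_coset_subset_G by blast
  have "?C \<inter> (?C #> b) = {}"
    using int_pow_mult_b_notin c by (auto simp: r_coset_def generate_pow)
  moreover have fin_b: "finite (?C #> b)"
    using fin by (simp add: r_coset_def)
  ultimately show "card (carrier G) = 2 ^ (n + 1)"
    using card_Un_disjoint[OF fin fin_b] \<open>card (?C #> b) = card ?C\<close> card_C eq by simp
  show "finite (carrier G)"
    using fin fin_b eq by simp
qed

lemma common_element_quaternion: "common_element G (c [^] ((2::int) ^ (n - 1)))"
  unfolding common_element_def
proof (intro conjI ballI impI)
  let ?z = "c [^] ((2::int) ^ (n - 1))"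
  show z: "?z \<in> carrier G"
    using c by simp
  have "\<not> (2::nat) ^ n dvd 2 ^ (n - 1)"
    using n by (intro nat_dvd_not_less) auto
  then have "c [^] ((2::nat) ^ (n - 1)) \<noteq> \<one>"
    using pow_eq_id[OF c] ord_c by simp
  then show "?z \<noteq> \<one>"
    using int_pow_int[of G c "2 ^ (n - 1)"] by simp
  fix x assume x: "x \<in> carrier G" "x \<noteq> \<one>"
  from x(1) show "?z \<in> generate G {x}"
  proof (cases rule: carrier_cases)
    case inside
    have two: "prime (2::nat)"
      by simp
    obtain i where i: "i < n" "generate G {x} = generate G {c [^] ((2::nat) ^ i)}"
      using generate_prime_power_order[OF two c ord_c inside x(2)] .
    then have "c [^] ((2::nat) ^ (n - 1)) \<in> generate G {x}"
      using pow_mem_generate_pow[OF c, of i "n - 1" 2] by simp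
    then show ?thesis
      using int_pow_int[of G c "2 ^ (n - 1)"] by simp
  next
    case (outside j)
    then show ?thesis
      using square_outside[of j] nat_pow_mem_generate[OF x(1), of 2] by simp
  qed
qed

text \<open>An element \<open>x = c ^ i b\<close> has order \<open>4\<close>, and its odd powers are \<open>x\<close> and \<open>x ^ 3 = c ^ (2 ^ (n - 1) + i) b\<close>.
  So each cyclic subgroup outside \<open>\<langle>c\<rangle>\<close> accounts for two of the \<open>2 ^ n\<close> elements there, which
  gives \<open>2 ^ (n - 1)\<close> such subgroups.\<close>

lemma mem_generate_outside_iff:
  "c [^] (j::int) \<otimes> b \<in> generate G {c [^] (i::int) \<otimes> b} \<longleftrightarrow> [j = i] (mod (2 ^ (n - 1)))"
proof -
  let ?x = "c [^] i \<otimes> b" and ?N = "(2::int) ^ (n - 1)"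
  have x: "?x \<in> carrier G"
    using c b by simp
  have even: "?x [^] (2 * q) = c [^] (?N * q)" for q :: int
  proof -
    have "?x [^] (2 * q) = (?x [^] (2::int)) [^] q"
      using x by (simp add: int_pow_pow)
    also have "?x [^] (2::int) = c [^] ?N"
      using square_outside[of i] int_pow_int[of G ?x 2] by simp
    finally show ?thesis
      using c by (simp add: int_pow_pow)
  qed
  have odd: "?x [^] (2 * q + 1) = c [^] (?N * q + i) \<otimes> b" for q :: int
    using x c b even by (simp add: int_pow_mult m_assoc)
  show ?thesis
  proof
    assume "c [^] j \<otimes> b \<in> generate G {?x}"
    then obtain k :: int where k: "c [^] j \<otimes> b = ?x [^] k"
      using x mem_generate_singleton_iff by blast
    have "odd k"
    proof
      assume "even k"
      then obtain q where "k = 2 * q" ..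
      then have "c [^] j \<otimes> b \<in> generate G {c}"
        using k even int_pow_mem_generate[OF c] by metis
      then show False
        using int_pow_mult_b_notin by blast
    qed
    then obtain q where "k = 2 * q + 1" ..
    then have "c [^] j \<otimes> b = c [^] (?N * q + i) \<otimes> b"
      using k odd by metis
    then have "c [^] j = c [^] (?N * q + i)"
      using c b by (metis int_pow_closed right_cancel)
    then have "[j = ?N * q + i] (mod (2 ^ n))"
      by (simp add: int_pow_eq_iff_cong c ord_c)
    then have "[j = ?N * q + i] (mod ?N)"
      by (rule cong_dvd_modulus) (simp add: le_imp_power_dvd)
    then show "[j = i] (mod ?N)"
      by (simp add: cong_def)
  next
    assume "[j = i] (mod ?N)"
    then obtain q where "j = ?N * q + i"
      by (metis cong_iff_lin cong_sym add.commute)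
    then have "c [^] j \<otimes> b = ?x [^] (2 * q + 1)"
      using odd by metis
    then show "c [^] j \<otimes> b \<in> generate G {?x}"
      using int_pow_mem_generate[OF x] by metis
  qed
qed

lemma not_cyclic: "x \<in> carrier G \<Longrightarrow> generate G {x} \<noteq> carrier G"
proof
  assume x: "x \<in> carrier G" and gen: "generate G {x} = carrier G"
  obtain i j :: int where "b = x [^] i" "c = x [^] j"
    using b c x unfolding gen[symmetric] mem_generate_singleton_iff[OF x] by blast
  then have "b \<otimes> c = c \<otimes> b"
    using x by (metis add.commute int_pow_mult)
  then have "c [^] (1::int) \<otimes> b = c [^] (- 1 :: int) \<otimes> b"
    using conj_b c by simp
  then have "c [^] (1::int) = c [^] (- 1 :: int)"
    using c b by (metis int_pow_closed right_cancel)
  then have "[1 = - 1] (mod (2 ^ n :: int))"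
    unfolding int_pow_eq_iff_cong[OF c] ord_c by simp
  moreover have "(4::int) dvd 2 ^ n"
    using le_imp_power_dvd[OF n, of "2::int"] by simp
  ultimately have "[1 = - 1] (mod (4::int))"
    by (rule cong_dvd_modulus)
  then show False
    by (simp add: cong_def)
qed

lemma card_proper_cyclic_subgroups_quaternion:
  "card (proper_cyclic_subgroups G) = 2 ^ (n - 1) + n"
proof -
  let ?gen = "\<lambda>x. generate G {x}"
  let ?in = "(\<lambda>i. ?gen (c [^] ((2::nat) ^ i))) ` {..<n}"
  let ?out = "(\<lambda>i. ?gen (c [^] (i::int) \<otimes> b)) ` {0..<2 ^ (n - 1)}"
  have two: "prime (2::nat)"
    by simp
  have same: "?gen (c [^] j \<otimes> b) = ?gen (c [^] i \<otimes> b)" if "[j = i] (mod (2 ^ (n - 1)))" for i j :: int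
  proof -
    have "c [^] j \<otimes> b \<in> ?gen (c [^] i \<otimes> b)" "c [^] i \<otimes> b \<in> ?gen (c [^] j \<otimes> b)"
      using that by (auto simp: mem_generate_outside_iff cong_sym_eq)
    then show ?thesis
      using c b by (intro equalityI generate_singleton_subset) auto
  qed
  have out_mod: "?gen (c [^] j \<otimes> b) \<in> ?out" for j :: int
  proof (rule image_eqI)
    show "?gen (c [^] j \<otimes> b) = ?gen (c [^] (j mod 2 ^ (n - 1)) \<otimes> b)"
      by (rule same) (simp add: cong_def)
  qed simp
  have "?gen ` (carrier G - {\<one>}) = ?in \<union> ?out"
  proof (intro equalityI subsetI)
    fix H assume "H \<in> ?gen ` (carrier G - {\<one>})"
    then obtain x where x: "x \<in> carrier G" "x \<noteq> \<one>" "H = ?gen x"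
      by blast
    from x(1) show "H \<in> ?in \<union> ?out"
    proof (cases rule: carrier_cases)
      case inside
      then have "H \<in> ?gen ` (generate G {c} - {\<one>})"
        using x by blast
      then show ?thesis
        using generates_of_prime_power_order[OF two c ord_c] by simp
    next
      case (outside j)
      then show ?thesis
        using out_mod x(3) by simp
    qed
  next
    fix H assume "H \<in> ?in \<union> ?out"
    then show "H \<in> ?gen ` (carrier G - {\<one>})"
    proof
      assume "H \<in> ?in"
      then have "H \<in> ?gen ` (generate G {c} - {\<one>})"
        using generates_of_prime_power_order[OF two c ord_c] by simp
      then show ?thesis
        using subgroup.subset[OF subgroup_generate_singleton[OF c]] by blast
    next
      assume "H \<in> ?out"
      then obtain i :: int where i: "H = ?gen (c [^] i \<otimes> b)"
        by blast
      have "c [^] i \<otimes> b \<noteq> \<one>"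
        using int_pow_mult_b_notin[of i] generate.one by metis
      then show ?thesis
        using i c b by blast
    qed
  qed
  moreover have "carrier G \<notin> ?gen ` (carrier G - {\<one>})"
  proof
    assume "carrier G \<in> ?gen ` (carrier G - {\<one>})"
    then obtain x where "x \<in> carrier G" "carrier G = ?gen x"
      by blast
    then show False
      by (metis not_cyclic)
  qed
  ultimately have "proper_cyclic_subgroups G = ?in \<union> ?out"
    unfolding proper_cyclic_subgroups_eq by (metis Diff_empty Diff_insert0)
  moreover have "?in \<inter> ?out = {}"
  proof -
    have "?gen (c [^] ((2::nat) ^ i)) \<noteq> ?gen (c [^] (j::int) \<otimes> b)" for i j
    proof
      assume eq: "?gen (c [^] ((2::nat) ^ i)) = ?gen (c [^] j \<otimes> b)"
      have "c [^] j \<otimes> b \<in> ?gen (c [^] ((2::nat) ^ i))"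
        unfolding eq by (simp add: generate.incl)
      then show False
        using generate_singleton_trans[OF c nat_pow_mem_generate[OF c]] int_pow_mult_b_notin by metis
    qed
    then show ?thesis
      by blast
  qed
  moreover have "card ?in = n"
    using card_image[OF inj_on_generate_prime_power[OF two c ord_c]] by simp
  moreover have "card ?out = 2 ^ (n - 1)"
  proof -
    have "inj_on (\<lambda>i. ?gen (c [^] (i::int) \<otimes> b)) {0..<2 ^ (n - 1)}"
    proof (rule inj_onI)
      fix i j :: int
      assume ij: "i \<in> {0..<2 ^ (n - 1)}" "j \<in> {0..<2 ^ (n - 1)}"
        and eq: "?gen (c [^] i \<otimes> b) = ?gen (c [^] j \<otimes> b)"
      have "c [^] i \<otimes> b \<in> ?gen (c [^] j \<otimes> b)"
        unfolding eq[symmetric] by (simp add: generate.incl)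
      then show "i = j"
        using ij by (simp add: mem_generate_outside_iff cong_def)
    qed
    then show ?thesis
      by (simp add: card_image nat_power_eq)
  qed
  ultimately show ?thesis
    by (simp add: card_Un_disjoint)
qed

end


section \<open>Presented groups\<close>

abbreviation word_class :: "('g word \<times> 'g word) set \<Rightarrow> 'g word \<Rightarrow> 'g word set" where
  "word_class R u \<equiv> {w. word_eq R u w}"

definition eval_word :: "('a, 'b) monoid_scheme \<Rightarrow> ('g \<Rightarrow> 'a) \<Rightarrow> 'g word \<Rightarrow> 'a" where
  "eval_word H f w = foldr (\<lambda>(i, x) y. (if i then inv\<^bsub>H\<^esub> f x else f x) \<otimes>\<^bsub>H\<^esub> y) w \<one>\<^bsub>H\<^esub>"

lemma (in group) eval_word_closed:
  "(\<And>x. f x \<in> carrier G) \<Longrightarrow> eval_word G f w \<in> carrier G"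
  by (induction w) (auto simp: eval_word_def)

lemma (in group) eval_word_append:
  "(\<And>x. f x \<in> carrier G) \<Longrightarrow> eval_word G f (u @ v) = eval_word G f u \<otimes> eval_word G f v"
proof (induction u)
  case Nil
  then show ?case
    using eval_word_closed[of f v] by (simp add: eval_word_def)
next
  case (Cons l u)
  note f = Cons.prems
  have "eval_word G f u \<in> carrier G" "eval_word G f v \<in> carrier G"
    using eval_word_closed Cons.prems by blast+
  then show ?case
    using Cons f by (cases l) (simp add: eval_word_def m_assoc)
qed

lemma (in group) eval_word_replicate:
  "f x \<in> carrier G \<Longrightarrow> eval_word G f (replicate k (False, x)) = f x [^] k"
proof (induction k)
  case (Suc k)
  then show ?case
    unfolding nat_pow_Suc2[OF Suc.prems] by (simp add: eval_word_def)
qed (simp add: eval_word_def)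

lemma (in group) eval_word_eq:
  assumes f: "\<And>x. f x \<in> carrier G"
    and R: "\<And>u v. (u, v) \<in> R \<Longrightarrow> eval_word G f u = eval_word G f v"
    and "word_eq R u v"
  shows "eval_word G f u = eval_word G f v"
  using assms(3)
proof induction
  case (cancel i x)
  show ?case
    using f[of x] by (auto simp: eval_word_def)
qed (use R in \<open>simp_all add: eval_word_append[OF f]\<close>)

text \<open>The universal property of the presentation: every rule that generates \<open>word_eq\<close> preserves the
  value of a word, so evaluation is constant on the classes.\<close>

lemma (in group) von_Dyck:
  assumes f: "\<And>x. f x \<in> carrier G"
    and R: "\<And>u v. (u, v) \<in> R \<Longrightarrow> eval_word G f u = eval_word G f v"
  shows "\<exists>h\<in>hom (presented_group R) G. \<forall>u. h (word_class R u) = eval_word G f u"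
proof (intro bexI allI)
  let ?h = "\<lambda>X. eval_word G f (SOME u. u \<in> X)"
  show h: "?h (word_class R u) = eval_word G f u" for u
  proof -
    have "(SOME w. w \<in> word_class R u) \<in> word_class R u"
      by (rule someI[of _ u]) (simp add: word_eq.refl)
    then show ?thesis
      using eval_word_eq[OF f R, where v = "SOME w. w \<in> word_class R u"] by simp
  qed
  show "?h \<in> hom (presented_group R) G"
  proof (rule homI)
    fix X Y assume "X \<in> carrier (presented_group R)" "Y \<in> carrier (presented_group R)"
    then obtain u v where "X = word_class R u" "Y = word_class R v"
      by (auto simp: presented_group_carrier)
    then show "?h (X \<otimes>\<^bsub>presented_group R\<^esub> Y) = ?h X \<otimes> ?h Y"
      by (simp only: presented_group_mult h eval_word_append[OF f])
  qed (rule eval_word_closed[OF f])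
qed

lemma presented_group_one: "\<one>\<^bsub>presented_group R\<^esub> = word_class R []"
  by (simp add: presented_group_def)

lemma word_class_in_carrier: "word_class R u \<in> carrier (presented_group R)"
  by (auto simp: presented_group_carrier)

lemma word_class_eqI: "word_eq R u v \<Longrightarrow> word_class R u = word_class R v"
  by (auto intro: word_eq.sym word_eq.trans)

lemma word_class_inverse_letter:
  "word_class R [(True, x)] = inv\<^bsub>presented_group R\<^esub> word_class R [(False, x)]"
proof (rule group.inv_equality[OF group_presented_group, symmetric])
  have "word_eq R [(True, x), (False, x)] []"
    using word_eq.cancel[of R True x] by simp
  then show "word_class R [(True, x)] \<otimes>\<^bsub>presented_group R\<^esub> word_class R [(False, x)] = \<one>\<^bsub>presented_group R\<^esub>"
    by (simp only: presented_group_mult presented_group_one append.simps word_class_eqI)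
qed (rule word_class_in_carrier)+

lemma word_class_replicate:
  "word_class R (replicate k l) = word_class R [l] [^]\<^bsub>presented_group R\<^esub> k"
proof (induction k)
  case (Suc k)
  have "word_class R (replicate (Suc k) l) = word_class R (replicate k l @ [l])"
    by (simp flip: replicate_append_same)
  then show ?case
    by (simp only: presented_group_mult[symmetric] Suc nat_pow_Suc)
qed (simp add: presented_group_one)

text \<open>Every class of words is a product of classes of letters and their inverses.\<close>

lemma presented_group_generated:
  assumes S: "subgroup S (presented_group R)" and gen: "\<And>x. word_class R [(False, x)] \<in> S"
  shows "S = carrier (presented_group R)"
proof
  interpret subgroup S "presented_group R"
    by (rule S)
  show "S \<subseteq> carrier (presented_group R)"
    by (rule subset)
  have "word_class R u \<in> S" for u
  proof (induction u)
    case Nil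
    then show ?case
      using one_closed by (simp add: presented_group_one)
  next
    case (Cons l u)
    obtain i x where l: "l = (i, x)"
      by (cases l)
    have "word_class R [l] \<in> S"
      using gen[of x] m_inv_closed[OF gen[of x]]
      by (cases i) (simp_all only: l word_class_inverse_letter)
    then have "word_class R [l] \<otimes>\<^bsub>presented_group R\<^esub> word_class R u \<in> S"
      using Cons by (rule m_closed)
    then show ?case
      by (simp only: presented_group_mult append.simps)
  qed
  then show "carrier (presented_group R) \<subseteq> S"
    by (auto simp: presented_group_carrier)
qed


section \<open>Generalized quaternion groups\<close>

text \<open>The parameter is \<open>n = \<alpha> - 1\<close>, the exponent of the order of the cyclic subgroup of index \<open>2\<close>.\<close>

definition quaternion_relations :: "nat \<Rightarrow> (quaternion_gen word \<times> quaternion_gen word) set" where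
  "quaternion_relations n =
     {(replicate (2 ^ n) (False, gen_a), []),
      ([(False, gen_b), (False, gen_b)], replicate (2 ^ (n - 1)) (False, gen_a)),
      ([(False, gen_b), (False, gen_a), (True, gen_b)], [(True, gen_a)])}"

lemma generalized_quaternion_group_eq:
  "generalized_quaternion_group \<alpha> = presented_group (quaternion_relations (\<alpha> - 1))"
proof -
  have "\<alpha> - 2 = \<alpha> - 1 - 1"
    by simp
  then show ?thesis
    unfolding generalized_quaternion_group_def quaternion_relations_def Let_def by (simp only:)
qed

lemma (in group) quaternion_relations_hom:
  assumes c: "c \<in> carrier G" and b: "b \<in> carrier G" and "c [^] ((2::nat) ^ n) = \<one>"
    and "b [^] (2::nat) = c [^] ((2::nat) ^ (n - 1))" and "b \<otimes> c = inv c \<otimes> b"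
  obtains h where "h \<in> hom (presented_group (quaternion_relations n)) G"
    and "h (word_class (quaternion_relations n) [(False, gen_a)]) = c"
    and "h (word_class (quaternion_relations n) [(False, gen_b)]) = b"
proof -
  let ?f = "\<lambda>x. case x of gen_a \<Rightarrow> c | gen_b \<Rightarrow> b"
  have f: "?f x \<in> carrier G" for x
    using c b by (cases x) auto
  have a: "eval_word G ?f (replicate k (False, gen_a)) = c [^] k" for k
    using eval_word_replicate[of ?f gen_a k] c by simp
  have "eval_word G ?f u = eval_word G ?f v" if uv: "(u, v) \<in> quaternion_relations n" for u v
  proof -
    consider "u = replicate (2 ^ n) (False, gen_a)" "v = []"
      | "u = [(False, gen_b), (False, gen_b)]" "v = replicate (2 ^ (n - 1)) (False, gen_a)"
      | "u = [(False, gen_b), (False, gen_a), (True, gen_b)]" "v = [(True, gen_a)]"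
      using uv by (auto simp: quaternion_relations_def)
    then show ?thesis
    proof cases
      case 1
      then show ?thesis
        using a assms(3) by (simp add: eval_word_def)
    next
      case 2
      have "eval_word G ?f u = b [^] (2::nat)"
        using 2 b by (simp add: eval_word_def numeral_2_eq_2)
      then show ?thesis
        using a assms(4) 2 by simp
    next
      case 3
      have "eval_word G ?f u = b \<otimes> c \<otimes> inv b"
        using 3 b c by (simp add: eval_word_def m_assoc)
      also have "\<dots> = inv c"
        using assms(5) b c by (simp add: m_assoc)
      finally show ?thesis
        using 3 c by (simp add: eval_word_def)
    qed
  qed
  from von_Dyck[OF f this] obtain h where h: "h \<in> hom (presented_group (quaternion_relations n)) G"
    "\<forall>u. h (word_class (quaternion_relations n) u) = eval_word G ?f u"
    by blast
  show ?thesis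
    by (rule that[OF h(1)]) (simp_all add: h(2) eval_word_def c b)
qed

text \<open>The relations move all powers of \<open>c\<close> to the left of \<open>b\<close>. This bounds the order of a group
  generated by \<open>c\<close> and \<open>b\<close> from above.\<close>

lemma (in group) subgroup_generate_union_coset:
  assumes c: "c \<in> carrier G" and b: "b \<in> carrier G"
    and b_square: "b [^] (2::nat) \<in> generate G {c}" and b_inverts: "b \<otimes> c = inv c \<otimes> b"
  shows "subgroup (generate G {c} \<union> (generate G {c} #> b)) G"
proof -
  obtain m :: int where m: "b [^] (2::nat) = c [^] m"
    using b_square c mem_generate_singleton_iff by blast
  have bb: "b \<otimes> b = c [^] m"
    using m b by (simp add: numeral_2_eq_2)
  have conj: "b \<otimes> c = c [^] (- 1 :: int) \<otimes> b"
    using b_inverts c by (simp add: int_pow_neg)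
  have b_pow: "b \<otimes> c [^] (j::int) = c [^] (- j) \<otimes> b" for j
    using conj_int_pow[OF c b conj] by simp
  let ?S = "range (\<lambda>j::int. c [^] j) \<union> range (\<lambda>j::int. c [^] j \<otimes> b)"
  have out_in: "c [^] i \<otimes> b \<otimes> c [^] j = c [^] (i - j) \<otimes> b" for i j :: int
  proof -
    have "c [^] i \<otimes> b \<otimes> c [^] j = c [^] i \<otimes> (b \<otimes> c [^] j)"
      using b c by (simp add: m_assoc)
    also have "\<dots> = c [^] (i + - j) \<otimes> b"
      unfolding b_pow using b c by (simp only: int_pow_mult[OF c]) (simp add: m_assoc)
    finally show ?thesis
      by simp
  qed
  have out_out: "c [^] i \<otimes> b \<otimes> (c [^] j \<otimes> b) = c [^] (i - j + m)" for i j :: int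
  proof -
    have "c [^] i \<otimes> b \<otimes> (c [^] j \<otimes> b) = c [^] i \<otimes> b \<otimes> c [^] j \<otimes> b"
      using b c by (simp add: m_assoc)
    also have "\<dots> = c [^] (i - j) \<otimes> (b \<otimes> b)"
      unfolding out_in using b c by (simp add: m_assoc)
    finally show ?thesis
      unfolding bb by (simp only: int_pow_mult[OF c])
  qed
  have in_out: "c [^] i \<otimes> (c [^] j \<otimes> b) = c [^] (i + j) \<otimes> b" for i j :: int
    using b c by (simp add: int_pow_mult m_assoc)
  have "subgroup ?S G"
  proof (rule subgroupI)
    show "inv x \<in> ?S" if x: "x \<in> ?S" for x
    proof -
      consider j :: int where "x = c [^] j" | j :: int where "x = c [^] j \<otimes> b"
        using x by blast
      then show ?thesis
      proof cases
        case 1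
        then have "inv x = c [^] (- j)"
          using c by (simp add: int_pow_neg)
        then show ?thesis
          by blast
      next
        case 2
        \<comment> \<open>Since \<open>b\<^sup>2 = c ^ m\<close>, the product of \<open>c ^ (j - m) b\<close> and \<open>c ^ j b\<close> is \<open>c ^ (j - m - j + m)\<close>.\<close>
        have "inv x = c [^] (j - m) \<otimes> b"
        proof (rule inv_equality)
          have "c [^] (j - m) \<otimes> b \<otimes> x = c [^] (0::int)"
            unfolding 2 out_out by simp
          then show "c [^] (j - m) \<otimes> b \<otimes> x = \<one>"
            by simp
        qed (use 2 c b in auto)
        then show ?thesis
          by blast
      qed
    qed
    show "x \<otimes> y \<in> ?S" if x: "x \<in> ?S" and y: "y \<in> ?S" for x y
    proof -
      have "c [^] i \<otimes> c [^] j = c [^] (i + j)" for i j :: int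
        using c by (simp add: int_pow_mult)
      then show ?thesis
        using x y by (auto simp: in_out out_in out_out)
    qed
  qed (use c b in auto)
  moreover have "?S = generate G {c} \<union> (generate G {c} #> b)"
    by (auto simp: generate_pow[OF c] r_coset_def)
  ultimately show ?thesis
    by simp
qed

text \<open>The pair \<open>(u, v)\<close> stands for the quaternion \<open>u + v j\<close>, where \<open>j u = cnj u j\<close> and \<open>j\<^sup>2 = - 1\<close>.\<close>

definition unit_quaternions :: "(complex \<times> complex) monoid" where
  "unit_quaternions =
     \<lparr> carrier = {(u, v). u * cnj u + v * cnj v = 1},
       monoid.mult = (\<lambda>(u, v) (s, t). (u * s - v * cnj t, u * t + v * cnj s)),
       one = (1, 0) \<rparr>"

lemma group_unit_quaternions: "group unit_quaternions"
proof (rule groupI)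
  fix x y assume "x \<in> carrier unit_quaternions" "y \<in> carrier unit_quaternions"
  then obtain u v s t where xy: "x = (u, v)" "y = (s, t)"
    and 1: "u * cnj u + v * cnj v = 1" "s * cnj s + t * cnj t = 1"
    by (auto simp: unit_quaternions_def)
  have "(u * s - v * cnj t) * cnj (u * s - v * cnj t) + (u * t + v * cnj s) * cnj (u * t + v * cnj s)
    = (u * cnj u + v * cnj v) * (s * cnj s + t * cnj t)"
    by (simp add: algebra_simps)
  then show "x \<otimes>\<^bsub>unit_quaternions\<^esub> y \<in> carrier unit_quaternions"
    by (simp add: unit_quaternions_def xy 1)
next
  fix x assume "x \<in> carrier unit_quaternions"
  then obtain u v where x: "x = (u, v)" and 1: "u * cnj u + v * cnj v = 1"
    by (auto simp: unit_quaternions_def)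
  show "\<exists>y\<in>carrier unit_quaternions. y \<otimes>\<^bsub>unit_quaternions\<^esub> x = \<one>\<^bsub>unit_quaternions\<^esub>"
    by (rule bexI[of _ "(cnj u, - v)"]) (use 1 in \<open>auto simp: unit_quaternions_def x mult.commute\<close>)
qed (auto simp: unit_quaternions_def algebra_simps)

lemma unit_quaternion_pow:
  "(u, 0) [^]\<^bsub>unit_quaternions\<^esub> (k::nat) = (u ^ k, 0)"
  by (induction k) (auto simp: unit_quaternions_def)

text \<open>What needs an argument is that the presented group is not too small: \<open>a\<close> must have order \<open>2 ^ n\<close> and \<open>b\<close>
  must not be a power of \<open>a\<close>. The homomorphism to the unit quaternions that sends \<open>a\<close> to a primitive
  root of unity \<open>\<zeta>\<close> of order \<open>2 ^ n\<close> and \<open>b\<close> to \<open>j\<close> shows both.\<close>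

lemma quaternion_generators_presented_group:
  assumes n: "n \<ge> 2"
  defines "R \<equiv> quaternion_relations n"
  shows "quaternion_generators (presented_group R) n
           (word_class R [(False, gen_a)]) (word_class R [(False, gen_b)])"
proof -
  let ?a = "word_class R [(False, gen_a)]" and ?b = "word_class R [(False, gen_b)]"
  interpret Q: group "presented_group R"
    by (rule group_presented_group)
  interpret U: group unit_quaternions
    by (rule group_unit_quaternions)
  note ab [simp] = word_class_in_carrier[of R "[(False, gen_a)]"] word_class_in_carrier[of R "[(False, gen_b)]"]

  have a_pow: "?a [^]\<^bsub>presented_group R\<^esub> ((2::nat) ^ n) = \<one>\<^bsub>presented_group R\<^esub>"
    unfolding word_class_replicate[symmetric] presented_group_one
    by (intro word_class_eqI word_eq.rel) (simp add: R_def quaternion_relations_def)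
  have b_square: "?b [^]\<^bsub>presented_group R\<^esub> (2::nat) = ?a [^]\<^bsub>presented_group R\<^esub> ((2::nat) ^ (n - 1))"
    unfolding word_class_replicate[symmetric]
    by (intro word_class_eqI word_eq.rel) (simp add: R_def quaternion_relations_def numeral_2_eq_2)
  have "word_class R [(False, gen_b), (False, gen_a), (True, gen_b)] = word_class R [(True, gen_a)]"
    by (intro word_class_eqI word_eq.rel) (simp add: R_def quaternion_relations_def)
  moreover have "word_class R [(False, gen_b), (False, gen_a), (True, gen_b)]
      = word_class R ([(False, gen_b)] @ [(False, gen_a)] @ [(True, gen_b)])"
    by simp
  ultimately have "?b \<otimes>\<^bsub>presented_group R\<^esub> (?a \<otimes>\<^bsub>presented_group R\<^esub> inv\<^bsub>presented_group R\<^esub> ?b) = inv\<^bsub>presented_group R\<^esub> ?a"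
    by (simp only: presented_group_mult[symmetric] word_class_inverse_letter)
  then have b_inverts: "?b \<otimes>\<^bsub>presented_group R\<^esub> ?a = inv\<^bsub>presented_group R\<^esub> ?a \<otimes>\<^bsub>presented_group R\<^esub> ?b"
    by (simp only: Q.m_assoc[symmetric] Q.inv_solve_right' Q.inv_closed Q.m_closed ab)

  define \<zeta> where "\<zeta> = cis (2 * pi / 2 ^ n)"
  have \<zeta>_pow: "\<zeta> ^ k = cis (2 * pi * (real k / 2 ^ n))" for k
    by (simp add: \<zeta>_def DeMoivre mult_ac)
  have \<zeta>_cnj: "\<zeta> * cnj \<zeta> = 1"
    by (simp add: \<zeta>_def cis_cnj cis_mult)
  have \<zeta>_half: "\<zeta> ^ (2 ^ (n - 1)) = - 1"
  proof -
    have "(2::real) ^ n = 2 * 2 ^ (n - 1)"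
      using n by (simp flip: power_Suc)
    then show ?thesis
      by (simp add: \<zeta>_pow)
  qed
  have \<zeta>_ord: "2 ^ n dvd k" if "\<zeta> ^ k = 1" for k
  proof -
    have "cos (2 * pi * (real k / 2 ^ n)) = 1"
      using that by (simp add: \<zeta>_pow complex_eq_iff)
    then obtain j :: int where "2 * pi * (real k / 2 ^ n) = real_of_int j * (2 * pi)"
      unfolding cos_one_2pi_int by (auto simp: mult_ac)
    then have "real k = real_of_int j * 2 ^ n"
      by (simp add: field_simps)
    then have "int k = j * 2 ^ n"
      by (metis of_int_eq_iff of_int_mult of_int_numeral of_int_of_nat_eq of_int_power)
    then have "int (2 ^ n) dvd int k"
      by simp
    then show ?thesis
      by (simp only: int_dvd_int_iff)
  qed
  let ?c = "(\<zeta>, 0)" and ?d = "(0, 1)"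
  have c: "?c \<in> carrier unit_quaternions" and d: "?d \<in> carrier unit_quaternions"
    using \<zeta>_cnj by (auto simp: unit_quaternions_def)
  have inv_c: "inv\<^bsub>unit_quaternions\<^esub> ?c = (cnj \<zeta>, 0)"
    by (rule U.inv_equality) (use \<zeta>_cnj in \<open>auto simp: unit_quaternions_def mult.commute\<close>)
  have "\<zeta> ^ (2 ^ n) = 1"
    using \<zeta>_pow[of "2 ^ n"] by simp
  then have "?c [^]\<^bsub>unit_quaternions\<^esub> ((2::nat) ^ n) = \<one>\<^bsub>unit_quaternions\<^esub>"
    by (simp add: unit_quaternion_pow) (simp add: unit_quaternions_def)
  moreover have "?d [^]\<^bsub>unit_quaternions\<^esub> (2::nat) = ?c [^]\<^bsub>unit_quaternions\<^esub> ((2::nat) ^ (n - 1))"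
    unfolding unit_quaternion_pow \<zeta>_half by (simp add: unit_quaternions_def numeral_2_eq_2)
  moreover have "?d \<otimes>\<^bsub>unit_quaternions\<^esub> ?c = inv\<^bsub>unit_quaternions\<^esub> ?c \<otimes>\<^bsub>unit_quaternions\<^esub> ?d"
    unfolding inv_c by (simp add: unit_quaternions_def)
  ultimately obtain h where h: "h \<in> hom (presented_group R) unit_quaternions" "h ?a = ?c" "h ?b = ?d"
    using U.quaternion_relations_hom[OF c d] unfolding R_def by blast
  interpret h: group_hom "presented_group R" unit_quaternions h
    using h(1) by unfold_locales

  have ord_a: "Q.ord ?a = 2 ^ n"
    unfolding Q.ord_unique[OF ab(1)]
  proof
    fix k :: nat
    show "?a [^]\<^bsub>presented_group R\<^esub> k = \<one>\<^bsub>presented_group R\<^esub> \<longleftrightarrow> 2 ^ n dvd k"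
    proof
      assume "?a [^]\<^bsub>presented_group R\<^esub> k = \<one>\<^bsub>presented_group R\<^esub>"
      then have "?c [^]\<^bsub>unit_quaternions\<^esub> k = \<one>\<^bsub>unit_quaternions\<^esub>"
        using h.hom_nat_pow[OF ab(1), of k] h(2) by simp
      then show "2 ^ n dvd k"
        using \<zeta>_ord unfolding unit_quaternion_pow by (simp add: unit_quaternions_def)
    next
      assume "2 ^ n dvd k"
      then show "?a [^]\<^bsub>presented_group R\<^esub> k = \<one>\<^bsub>presented_group R\<^esub>"
        using a_pow by (metis Q.pow_eq_id ab(1) dvd_trans)
    qed
  qed
  have b_notin: "?b \<notin> generate (presented_group R) {?a}"
  proof
    assume "?b \<in> generate (presented_group R) {?a}"
    moreover have "Q.ord ?a \<noteq> 0"
      by (simp add: ord_a)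
    ultimately obtain k :: nat where "?b = ?a [^]\<^bsub>presented_group R\<^esub> k"
      using Q.generate_pow_nat[OF ab(1)] by auto
    then have "?d = ?c [^]\<^bsub>unit_quaternions\<^esub> k"
      using h.hom_nat_pow[OF ab(1), of k] h(2,3) by simp
    then show False
      by (simp add: unit_quaternion_pow)
  qed
  have "?b [^]\<^bsub>presented_group R\<^esub> (2::nat) \<in> generate (presented_group R) {?a}"
    unfolding b_square by (rule Q.nat_pow_mem_generate[OF ab(1)])
  then have sub: "subgroup (generate (presented_group R) {?a} \<union> (generate (presented_group R) {?a} #>\<^bsub>presented_group R\<^esub> ?b))
      (presented_group R)" (is "subgroup ?S _")
    using Q.subgroup_generate_union_coset[OF ab] b_inverts by blast
  have "word_class R [(False, x)] \<in> ?S" for x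
  proof (cases x)
    case gen_a
    then show ?thesis
      by (simp add: generate.incl)
  next
    case gen_b
    have "?b \<in> generate (presented_group R) {?a} #>\<^bsub>presented_group R\<^esub> ?b"
      by (rule Q.rcos_self[OF ab(2) Q.subgroup_generate_singleton[OF ab(1)]])
    then show ?thesis
      by (simp add: gen_b)
  qed
  then have "carrier (presented_group R) = ?S"
    using presented_group_generated[OF sub] by blast
  then have "carrier (presented_group R) \<subseteq> ?S"
    by (rule equalityD1)
  then show ?thesis
    by (intro quaternion_generators.intro quaternion_generators_axioms.intro group_presented_group
        ab n ord_a b_notin b_square b_inverts)
qed

text \<open>The relations give a homomorphism from the presented group onto \<open>G\<close>. Both groups have order
  \<open>2 ^ (n + 1)\<close>, so it is bijective.\<close>

lemma (in quaternion_generators) iso_generalized_quaternion_group: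
  "G \<cong> generalized_quaternion_group (n + 1)"
proof -
  let ?R = "quaternion_relations n"
  interpret Q: quaternion_generators "presented_group ?R" n
      "word_class ?R [(False, gen_a)]" "word_class ?R [(False, gen_b)]"
    by (rule quaternion_generators_presented_group[OF n])
  have "c [^] ((2::nat) ^ n) = \<one>"
    using pow_ord_eq_1[OF c] ord_c by simp
  then obtain h where h: "h \<in> hom (presented_group ?R) G"
    "h (word_class ?R [(False, gen_a)]) = c" "h (word_class ?R [(False, gen_b)]) = b"
    using quaternion_relations_hom[OF c b _ b_square b_inverts] by blast
  interpret h: group_hom "presented_group ?R" G h
    using h(1) by unfold_locales
  let ?I = "h ` carrier (presented_group ?R)"
  have I: "subgroup ?I G"
    by (rule h.img_is_subgroup)
  have "c \<in> ?I" "b \<in> ?I"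
    using h(2,3) Q.c Q.b by (metis image_eqI)+
  then have "generate G {c} \<subseteq> ?I"
    using I by (simp add: generate_subgroup_incl)
  have "x \<in> ?I" if x: "x \<in> carrier G" for x
    using x
  proof (cases rule: carrier_cases)
    case inside
    then show ?thesis
      using \<open>generate G {c} \<subseteq> ?I\<close> by blast
  next
    case (outside j)
    have "c [^] j \<in> ?I"
      using \<open>generate G {c} \<subseteq> ?I\<close> int_pow_mem_generate[OF c] by blast
    then show ?thesis
      unfolding outside using \<open>b \<in> ?I\<close> by (rule subgroup.m_closed[OF I])
  qed
  then have "carrier G \<subseteq> ?I"
    by (rule subsetI)
  then have surj: "?I = carrier G"
    using subgroup.subset[OF I] by blast
  then have "inj_on h (carrier (presented_group ?R))"
    using Q.finite_carrier Q.card_carrier card_carrier by (intro eq_card_imp_inj_on) auto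
  then have "presented_group ?R \<cong> G"
    using surj h(1) by (auto simp: is_iso_def iso_def bij_betw_def)
  then show ?thesis
    unfolding generalized_quaternion_group_eq using Q.iso_sym by simp
qed


section \<open>Completeness of the intersection graph\<close>

lemma is_complete_graph_iff:
  "is_complete_graph (cyclic_intersection_graph G) \<longleftrightarrow>
     (\<forall>H\<in>proper_cyclic_subgroups G. \<forall>K\<in>proper_cyclic_subgroups G. H \<noteq> K \<longrightarrow> H \<inter> K \<noteq> {\<one>\<^bsub>G\<^esub>})"
  by (auto simp: is_complete_graph_def cyclic_intersection_graph_def)

lemma is_complete_graph_if_complete_digraph:
  "complete_digraph n \<Gamma> \<Longrightarrow> is_complete_graph \<Gamma>"
  by (auto simp: complete_digraph_def is_complete_graph_def)

context group
begin

text \<open>Take any \<open>z\<close> of prime order and another \<open>y\<close> of prime order. Subgroups of prime order that share a nontrivial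
  element coincide. Completeness gives such an element unless \<open>\<langle>z\<rangle>\<close> or \<open>\<langle>y\<rangle>\<close> is the whole group, and then one
  contains the other. So \<open>z \<in> \<langle>y\<rangle>\<close>, and every \<open>x \<noteq> \<one>\<close> has a power of prime order.\<close>

lemma common_element_if_complete:
  assumes fin: "finite (carrier G)" and "\<not> trivial_group G"
    and complete: "is_complete_graph (cyclic_intersection_graph G)"
  obtains z where "common_element G z" "prime (ord z)"
proof -
  obtain x where x: "x \<in> carrier G" "x \<noteq> \<one>"
    using assms(2) trivial_group_subset by auto
  obtain k :: nat where "prime (ord (x [^] k))"
    using exists_power_of_prime_order[OF fin x] .
  define z where "z = x [^] k"
  have z: "z \<in> carrier G" "prime (ord z)"
    using x(1) \<open>prime (ord (x [^] k))\<close> by (auto simp: z_def)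
  have ne_one: "w \<noteq> \<one>" if "prime (ord w)" for w
    using that by auto
  have z_mem: "z \<in> generate G {y}" if y: "y \<in> carrier G" "prime (ord y)" for y
  proof (rule ccontr)
    assume notin: "z \<notin> generate G {y}"
    have proper: "generate G {w} \<in> proper_cyclic_subgroups G"
      if "w \<in> carrier G" "prime (ord w)" "generate G {w} \<noteq> carrier G" for w
      using that ne_one[of w] unfolding proper_cyclic_subgroups_eq by blast
    have "generate G {y} \<noteq> carrier G"
      using notin z(1) by auto
    moreover have "generate G {z} \<noteq> carrier G"
      using notin generator_of_prime_order[OF z _ ne_one[OF y(2)]] y(1) by auto
    moreover have "generate G {z} \<noteq> generate G {y}"
      using notin generate.incl[of z "{z}" G] by auto
    ultimately have "generate G {z} \<inter> generate G {y} \<noteq> {\<one>}"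
      using complete proper[OF y] proper[OF z] unfolding is_complete_graph_iff by blast
    moreover have "\<one> \<in> generate G {z} \<inter> generate G {y}"
      by (simp add: generate.one)
    ultimately obtain w where w: "w \<in> generate G {z}" "w \<in> generate G {y}" "w \<noteq> \<one>"
      by blast
    then show False
      using generator_of_prime_order[OF z w(1,3)] generate_singleton_trans[OF y(1) w(2)] notin by blast
  qed
  have "z \<in> generate G {y}" if y: "y \<in> carrier G" "y \<noteq> \<one>" for y
  proof -
    obtain j :: nat where "prime (ord (y [^] j))"
      using exists_power_of_prime_order[OF fin y] .
    then have "z \<in> generate G {y [^] j}"
      using z_mem[of "y [^] j"] y(1) by simp
    then show ?thesis
      using generate_singleton_trans[OF y(1) nat_pow_mem_generate[OF y(1)]] by blast
  qed
  then show ?thesis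
    using that[of z] z ne_one[OF z(2)] unfolding common_element_def by blast
qed

text \<open>If a prime \<open>q\<close> divides the order, Sylow provides a subgroup with \<open>q\<close> elements. It contains \<open>z\<close>, so the
  order of \<open>z\<close> divides \<open>q\<close>.\<close>

lemma order_prime_power_if_common_element:
  assumes fin: "finite (carrier G)" and z: "common_element G z" and p: "prime (ord z)"
  obtains r where "order G = ord z ^ r"
proof -
  let ?p = "ord z"
  have zG: "z \<in> carrier G"
    using z by (simp add: common_element_def)
  have only: "q = ?p" if q: "prime q" "q dvd order G" for q
  proof -
    obtain m where "order G = q ^ 1 * m"
      using q(2) by auto
    then obtain H where H: "subgroup H G" "card H = q"
      using sylow_thm[OF q(1) is_group _ fin, of 1 m] by auto
    have "\<exists>y\<in>H. y \<noteq> \<one>"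
    proof (rule ccontr)
      assume "\<not> (\<exists>y\<in>H. y \<noteq> \<one>)"
      then have "H \<subseteq> {\<one>}"
        by blast
      then have "card H \<le> 1"
        by (metis card.empty card_mono finite.emptyI finite_insert One_nat_def card.insert_remove empty_Diff)
      then show False
        using H(2) prime_gt_1_nat[OF q(1)] by simp
    qed
    then obtain y where y: "y \<in> H" "y \<noteq> \<one>"
      by blast
    have yG: "y \<in> carrier G"
      by (rule subgroup.mem_carrier[OF H(1) y(1)])
    have "z \<in> generate G {y}"
      using z yG y(2) by (simp add: common_element_def)
    also have "generate G {y} \<subseteq> H"
      using y(1) H(1) by (simp add: generate_subgroup_incl)
    finally have "generate G {z} \<subseteq> H"
      using H(1) by (simp add: generate_subgroup_incl)
    then have "subgroup (generate G {z}) (G\<lparr>carrier := H\<rparr>)"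
      by (rule subgroup_incl[OF subgroup_generate_singleton[OF zG] H(1)])
    from group.lagrange[OF subgroup_imp_group[OF H(1)] this]
    have "card (rcosets\<^bsub>G\<lparr>carrier := H\<rparr>\<^esub> generate G {z}) * card (generate G {z}) = card H"
      by (simp add: order_def)
    then have "card (generate G {z}) dvd card H"
      by (metis dvd_triv_right)
    then have "?p dvd q"
      using generate_pow_card[OF zG] H(2) by simp
    then show ?thesis
      using p q(1) primes_dvd_imp_eq by blast
  qed
  have "order G \<noteq> 0"
    using fin order_gt_0_iff_finite by simp
  then obtain m where m: "order G = ?p ^ multiplicity ?p (order G) * m" "\<not> ?p dvd m"
    using multiplicity_decompose'[of "order G" ?p] p by (metis not_prime_unit)
  have "m = 1"
  proof (rule ccontr)
    assume "m \<noteq> 1"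
    then obtain q where q: "prime q" "q dvd m"
      using prime_factor_nat by blast
    then have "q dvd order G"
      using m(1) by (metis dvd_mult)
    then show False
      using only q m(2) by blast
  qed
  then show ?thesis
    using that m(1) by simp
qed

end

lemma complete_digraph_integer_mod_group:
  assumes p: "prime (p::nat)" and "\<alpha> \<ge> 1"
  shows "\<exists>z. common_element (integer_mod_group (p ^ \<alpha>)) z"
    and "complete_digraph (\<alpha> - 1) (cyclic_intersection_graph (integer_mod_group (p ^ \<alpha>)))"
proof -
  interpret Z: group "integer_mod_group (p ^ \<alpha>)"
    by simp
  have "p ^ \<alpha> > 1"
    using \<open>\<alpha> \<ge> 1\<close> prime_gt_1_nat[OF p] by (intro one_less_power) auto
  note gen = integer_mod_group_generator(1)[OF this] integer_mod_group_generator(3)[OF this]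
    integer_mod_group_generator(2)[OF this]
  show ex: "\<exists>z. common_element (integer_mod_group (p ^ \<alpha>)) z"
    using Z.common_element_cyclic[OF p gen \<open>\<alpha> \<ge> 1\<close>] by blast
  have "finite (carrier (integer_mod_group (p ^ \<alpha>)))"
    using prime_gt_0_nat[OF p] by (simp add: carrier_integer_mod_group)
  then show "complete_digraph (\<alpha> - 1) (cyclic_intersection_graph (integer_mod_group (p ^ \<alpha>)))"
    using Z.complete_digraph_if_common_element ex Z.card_proper_cyclic_subgroups_cyclic[OF p gen] by auto
qed

lemma complete_digraph_generalized_quaternion_group:
  assumes "\<alpha> \<ge> 3"
  shows "group (generalized_quaternion_group \<alpha>)"
    and "\<exists>z. common_element (generalized_quaternion_group \<alpha>) z"
    and "complete_digraph (2 ^ (\<alpha> - 2) + \<alpha> - 1)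
           (cyclic_intersection_graph (generalized_quaternion_group \<alpha>))"
proof -
  have "\<alpha> - 1 \<ge> 2"
    using assms by simp
  from quaternion_generators_presented_group[OF this]
  obtain a b where "quaternion_generators (generalized_quaternion_group \<alpha>) (\<alpha> - 1) a b"
    unfolding generalized_quaternion_group_eq by blast
  then interpret Q: quaternion_generators "generalized_quaternion_group \<alpha>" "\<alpha> - 1" a b .
  show "group (generalized_quaternion_group \<alpha>)"
    by (rule Q.is_group)
  show "\<exists>z. common_element (generalized_quaternion_group \<alpha>) z"
    using Q.common_element_quaternion by blast
  have "\<alpha> - 1 - 1 = \<alpha> - 2" "2 ^ (\<alpha> - 2) + (\<alpha> - 1) = 2 ^ (\<alpha> - 2) + \<alpha> - 1"
    using assms by auto
  then show "complete_digraph (2 ^ (\<alpha> - 2) + \<alpha> - 1)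
      (cyclic_intersection_graph (generalized_quaternion_group \<alpha>))"
    using Q.complete_digraph_if_common_element[OF Q.finite_carrier Q.common_element_quaternion]
      Q.card_proper_cyclic_subgroups_quaternion by simp
qed

theorem corollary2p2:
  fixes G :: "('a, 'b) monoid_scheme"
  assumes "group G" and "finite (carrier G)" and "\<not> trivial_group G"
  shows "(is_complete_graph (cyclic_intersection_graph G) \<longleftrightarrow>
            (\<exists>p \<alpha>. prime (p::nat) \<and> \<alpha> \<ge> 1 \<and> G \<cong> integer_mod_group (p ^ \<alpha>)) \<or>
            (\<exists>\<alpha>\<ge>3. G \<cong> generalized_quaternion_group \<alpha>))
       \<and> (\<forall>p \<alpha>. prime (p::nat) \<longrightarrow> \<alpha> \<ge> 1 \<longrightarrow>
            complete_digraph (\<alpha> - 1) (cyclic_intersection_graph (integer_mod_group (p ^ \<alpha>))))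
       \<and> (\<forall>\<alpha>\<ge>3. complete_digraph (2 ^ (\<alpha> - 2) + \<alpha> - 1)
            (cyclic_intersection_graph (generalized_quaternion_group \<alpha>)))"
proof (intro conjI)
  interpret group G
    by fact
  show "is_complete_graph (cyclic_intersection_graph G) \<longleftrightarrow>
            (\<exists>p \<alpha>. prime (p::nat) \<and> \<alpha> \<ge> 1 \<and> G \<cong> integer_mod_group (p ^ \<alpha>)) \<or>
            (\<exists>\<alpha>\<ge>3. G \<cong> generalized_quaternion_group \<alpha>)"
    (is "?complete \<longleftrightarrow> ?cyclic \<or> ?quaternion")
  proof
    assume ?complete
    then obtain z where z: "common_element G z" "prime (ord z)"
      using common_element_if_complete[OF assms(2,3)] by blast
    then obtain r where r: "order G = ord z ^ r"
      using order_prime_power_if_common_element[OF assms(2)] by blast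
    from assms(2) z(2) r z(1) show "?cyclic \<or> ?quaternion"
    proof (cases rule: cyclic_or_quaternion)
      case (cyclic c)
      have "ord c = order G"
        using generate_pow_card[OF cyclic(1)] cyclic(2) by (simp add: order_def)
      moreover have "order G > 0"
        using assms(2) order_gt_0_iff_finite by simp
      ultimately have "G \<cong> integer_mod_group (ord z ^ r)"
        using iso_integer_mod_group[OF cyclic] r by simp
      moreover have "r \<noteq> 0"
      proof
        assume "r = 0"
        then have "ord c = 1"
          using \<open>ord c = order G\<close> r by simp
        then have "c = \<one>\<^bsub>G\<^esub>"
          using ord_eq_1[OF cyclic(1)] by simp
        then have "carrier G = {\<one>\<^bsub>G\<^esub>}"
          using cyclic(2) generate_one by simp
        then show False
          using assms(3) trivial_group_subset by simp
      qed
      ultimately show ?thesis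
        using z(2) by (metis One_nat_def Suc_leI neq0_conv)
    next
      case (quaternion n c b)
      then interpret quaternion_generators G n c b .
      have "n + 1 \<ge> 3"
        using n by simp
      then show ?thesis
        using iso_generalized_quaternion_group by blast
    qed
  next
    assume "?cyclic \<or> ?quaternion"
    then have "\<exists>z. common_element G z"
    proof (elim disjE exE conjE)
      fix p \<alpha> assume "prime (p::nat)" "\<alpha> \<ge> 1" and iso: "G \<cong> integer_mod_group (p ^ \<alpha>)"
      then obtain z where "common_element (integer_mod_group (p ^ \<alpha>)) z"
        using complete_digraph_integer_mod_group(1) by blast
      then show ?thesis
        by (rule common_element_if_iso[OF group_integer_mod_group iso])
    next
      fix \<alpha> :: nat assume \<alpha>: "\<alpha> \<ge> 3" and iso: "G \<cong> generalized_quaternion_group \<alpha>"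
      obtain z where "common_element (generalized_quaternion_group \<alpha>) z"
        using complete_digraph_generalized_quaternion_group(2)[OF \<alpha>] by blast
      then show ?thesis
        by (rule common_element_if_iso[OF complete_digraph_generalized_quaternion_group(1)[OF \<alpha>] iso])
    qed
    then show ?complete
      using complete_digraph_if_common_element[OF assms(2)] is_complete_graph_if_complete_digraph by blast
  qed
qed (use complete_digraph_integer_mod_group(2) complete_digraph_generalized_quaternion_group(3) in blast)+

end
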